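(* Let $(X,\mathcal{F},m)$ be a $\sigma$-finite measure space and let $\mathcal{E}:\mathrm{L}^2(X,m)\to[0,\infty]$ be a non-bilinear Dirichlet form. Then $\mathcal{E}$ has the normal contraction property, i.e. $$\mathcal{E}(\phi\circ f)\leq \mathcal{E}(f)\qquad\text{for every normal contraction }\phi\text{ and every } f\in \mathrm{L}^2(X,m),$$ if and only if $$\mathcal{E}(-f)\leq \mathcal{E}(f)\qquad\text{for all } f\in \mathrm{L}^2(X,m).$$
   Context: $X$ is a nonempty set with a $\sigma$-algebra $\mathcal{F}$ and a $\sigma$-finite measure $m:\mathcal{F}\to[0,\infty]$; $\mathrm{L}^2(X,m)$ denotes real-valued square-integrable functions (up to $m$-null sets). All functionals are assumed not to be identically $+\infty$; l.s.c. means lower semicontinuous on $\mathrm{L}^2(X,m)$. Normal contraction: a $1$-Lipschitz function $\phi:\mathbb{R}\to\mathbb{R}$ with $\phi(0)=0$. Semigroup: for a convex l.s.c. functional $\mathcal{E}:\mathrm{L}^2(X,m)\to[0,\infty]$, let $(T_t)_{t\ge0}$ be the semigroup of nonlinear operators on $\mathrm{L}^2(X,m)$ generated by $-\partial\mathcal{E}$, where $\partial$ denotes the subdifferential operator, via the differential equation $$\partial_t T_tf\in-\partial\mathcal{E}(T_tf)\quad\text{for all }t\in(0,\infty)\text{ and all } f\in\mathrm{L}^2(X,m),\qquad T_0f=f\quad\text{for all } f\in\mathrm{L}^2(X,m).$$ This equation is taken to be well-posed for all $f\in\mathrm{L}^2(X,m)$; its solution is called the gradient flow of $\mathcal{E}$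 starting at $f$. Non-bilinear Dirichlet form: a non-negative l.s.c. functional $\mathcal{E}:\mathrm{L}^2(X,m)\to[0,\infty]$ that is convex and such that, for all $t\ge0$, the operator $T_t:\mathrm{L}^2(X,m)\to\mathrm{L}^2(X,m)$ satisfies: (1) (order preservation) $T_tf\le T_tg$ for all $f,g\in\mathrm{L}^2(X,m)$ with $f\le g$ (pointwise order up to a negligible set); (2) ($\mathrm{L}^\infty$-contraction) $\|T_tf-T_tg\|_\infty\le\|f-g\|_\infty$ for all $f,g\in\mathrm{L}^2(X,m)$. *)

theory Defs
  imports "HOL-Analysis.Analysis" "HOL-Probability.Essential_Supremum"
begin

text \<open>
  Elements of $L^2(X,m)$ are represented by real functions on the underlying type of the
  measure \<open>M\<close>; identification up to null sets is expressed by \<open>AE x in M\<close>. A functional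
  $L^2(X,m) \to [0,\infty]$ is a map \<open>('a \<Rightarrow> real) \<Rightarrow> ennreal\<close> that is compatible with this
  identification; its values outside \<open>L2 M\<close> play no role.
\<close>

definition L2 :: "'a measure \<Rightarrow> ('a \<Rightarrow> real) set" where
  "L2 M = {f. f \<in> borel_measurable M \<and> integrable M (\<lambda>x. (f x)\<^sup>2)}"

definition L2_inner :: "'a measure \<Rightarrow> ('a \<Rightarrow> real) \<Rightarrow> ('a \<Rightarrow> real) \<Rightarrow> real" where
  "L2_inner M f g = (\<integral>x. f x * g x \<partial>M)"

definition L2_norm :: "'a measure \<Rightarrow> ('a \<Rightarrow> real) \<Rightarrow> real" where
  "L2_norm M f = sqrt (\<integral>x. (f x)\<^sup>2 \<partial>M)"

definition Linf_norm :: "'a measure \<Rightarrow> ('a \<Rightarrow> real) \<Rightarrow> ennreal" where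
  "Linf_norm M f = esssup M (\<lambda>x. ennreal \<bar>f x\<bar>)"

definition L2_functional :: "'a measure \<Rightarrow> (('a \<Rightarrow> real) \<Rightarrow> ennreal) \<Rightarrow> bool" where
  "L2_functional M E \<longleftrightarrow> (\<forall>f\<in>L2 M. \<forall>g\<in>L2 M. (AE x in M. f x = g x) \<longrightarrow> E f = E g)"

definition effective_domain :: "'a measure \<Rightarrow> (('a \<Rightarrow> real) \<Rightarrow> ennreal) \<Rightarrow> ('a \<Rightarrow> real) set" where
  "effective_domain M E = {f \<in> L2 M. E f < \<infinity>}"

definition L2_convex :: "'a measure \<Rightarrow> (('a \<Rightarrow> real) \<Rightarrow> ennreal) \<Rightarrow> bool" where
  "L2_convex M E \<longleftrightarrow> (\<forall>f\<in>L2 M. \<forall>g\<in>L2 M. \<forall>s::real. 0 \<le> s \<and> s \<le> 1 \<longrightarrow>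
     E (\<lambda>x. (1 - s) * f x + s * g x) \<le> ennreal (1 - s) * E f + ennreal s * E g)"

definition L2_lsc :: "'a measure \<Rightarrow> (('a \<Rightarrow> real) \<Rightarrow> ennreal) \<Rightarrow> bool" where
  "L2_lsc M E \<longleftrightarrow> (\<forall>f\<in>L2 M. \<forall>c. c < E f \<longrightarrow>
     (\<exists>\<delta>>0. \<forall>g\<in>L2 M. L2_norm M (\<lambda>x. g x - f x) < \<delta> \<longrightarrow> c < E g))"

definition subdifferential ::
  "'a measure \<Rightarrow> (('a \<Rightarrow> real) \<Rightarrow> ennreal) \<Rightarrow> ('a \<Rightarrow> real) \<Rightarrow> ('a \<Rightarrow> real) set" where
  "subdifferential M E f = {v \<in> L2 M. \<forall>g\<in>L2 M.
     enn2ereal (E f) + ereal (L2_inner M v (\<lambda>x. g x - f x)) \<le> enn2ereal (E g)}"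

text \<open>
  \<open>nearest_in_closure M S f w\<close>: \<open>w\<close> is the metric projection of \<open>f\<close> onto the $L^2$-closure
  of \<open>S\<close>. If \<open>f\<close> itself lies in that closure, this says \<open>w = f\<close> almost everywhere.
\<close>

definition nearest_in_closure ::
  "'a measure \<Rightarrow> ('a \<Rightarrow> real) set \<Rightarrow> ('a \<Rightarrow> real) \<Rightarrow> ('a \<Rightarrow> real) \<Rightarrow> bool" where
  "nearest_in_closure M S f w \<longleftrightarrow> w \<in> L2 M \<and>
     (\<forall>\<epsilon>>0. \<exists>g\<in>S. L2_norm M (\<lambda>x. g x - w x) < \<epsilon>) \<and>
     (\<forall>g\<in>S. L2_norm M (\<lambda>x. f x - w x) \<le> L2_norm M (\<lambda>x. f x - g x))"

text \<open>
  The gradient flow of \<open>E\<close> starting at \<open>f\<close>: a curve \<open>u\<close> with \<open>u 0 = f\<close> and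
  $\partial_t u(t) \in -\partial E(u(t))$ for all \<open>t > 0\<close>.

  \<^item> The time derivative is the right derivative in $L^2$. A two-sided derivative does not exist
    at every \<open>t > 0\<close> (for \<open>E f = \<bar>f\<bar>\<close> on a one-point space the flow is \<open>max (f - t) 0\<close>
    if \<open>f \<ge> 0\<close>), whereas the solution of the Brezis--Komura theory has a right derivative at
    every \<open>t > 0\<close>, and together with continuity this determines it.

  \<^item> Since \<open>u t\<close> has finite energy for \<open>t > 0\<close>, continuity at \<open>0\<close> is possible only for \<open>f\<close>
    in the closure of the effective domain, and for such \<open>f\<close> the last condition is continuity
    at \<open>0\<close>. For the remaining \<open>f\<close> the usual convention is followed (the semigroup is extended
    from the closure of the domain to $L^2$ by the metric projection), so that the
    equation is meaningful for every initial value, with no density requirement on the domain.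
\<close>

definition gradient_flow ::
  "'a measure \<Rightarrow> (('a \<Rightarrow> real) \<Rightarrow> ennreal) \<Rightarrow> ('a \<Rightarrow> real) \<Rightarrow> (real \<Rightarrow> 'a \<Rightarrow> real) \<Rightarrow> bool" where
  "gradient_flow M E f u \<longleftrightarrow>
     (\<forall>t\<ge>0. u t \<in> L2 M) \<and>
     (AE x in M. u 0 x = f x) \<and>
     (\<forall>t>0. ((\<lambda>s. L2_norm M (\<lambda>x. u s x - u t x)) \<longlongrightarrow> 0) (at t)) \<and>
     (\<forall>t>0. \<exists>v\<in>subdifferential M E (u t).
        ((\<lambda>h. L2_norm M (\<lambda>x. (u (t + h) x - u t x) / h - (- v x))) \<longlongrightarrow> 0) (at_right 0)) \<and>
     (\<exists>w. nearest_in_closure M (effective_domain M E) f w \<and>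
        ((\<lambda>t. L2_norm M (\<lambda>x. u t x - w x)) \<longlongrightarrow> 0) (at_right 0))"

definition well_posed :: "'a measure \<Rightarrow> (('a \<Rightarrow> real) \<Rightarrow> ennreal) \<Rightarrow> bool" where
  "well_posed M E \<longleftrightarrow> (\<forall>f\<in>L2 M. \<exists>u. gradient_flow M E f u \<and>
     (\<forall>u'. gradient_flow M E f u' \<longrightarrow> (\<forall>t\<ge>0. AE x in M. u' t x = u t x)))"

definition flow_semigroup ::
  "'a measure \<Rightarrow> (('a \<Rightarrow> real) \<Rightarrow> ennreal) \<Rightarrow> real \<Rightarrow> ('a \<Rightarrow> real) \<Rightarrow> ('a \<Rightarrow> real)" where
  "flow_semigroup M E t f = (SOME u. gradient_flow M E f u) t"

definition order_preserving :: "'a measure \<Rightarrow> (('a \<Rightarrow> real) \<Rightarrow> ('a \<Rightarrow> real)) \<Rightarrow> bool" where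
  "order_preserving M T \<longleftrightarrow> (\<forall>f\<in>L2 M. \<forall>g\<in>L2 M.
     (AE x in M. f x \<le> g x) \<longrightarrow> (AE x in M. T f x \<le> T g x))"

definition Linf_contraction :: "'a measure \<Rightarrow> (('a \<Rightarrow> real) \<Rightarrow> ('a \<Rightarrow> real)) \<Rightarrow> bool" where
  "Linf_contraction M T \<longleftrightarrow> (\<forall>f\<in>L2 M. \<forall>g\<in>L2 M.
     Linf_norm M (\<lambda>x. T f x - T g x) \<le> Linf_norm M (\<lambda>x. f x - g x))"

text \<open>
  Well-posedness is listed because it is what makes \<open>flow_semigroup\<close>, which is
  defined by a choice operator, denote the gradient flow.
\<close>

definition nonbilinear_dirichlet_form :: "'a measure \<Rightarrow> (('a \<Rightarrow> real) \<Rightarrow> ennreal) \<Rightarrow> bool" where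
  "nonbilinear_dirichlet_form M E \<longleftrightarrow>
     L2_functional M E \<and> effective_domain M E \<noteq> {} \<and> L2_lsc M E \<and> L2_convex M E \<and>
     well_posed M E \<and>
     (\<forall>t\<ge>0. order_preserving M (flow_semigroup M E t) \<and> Linf_contraction M (flow_semigroup M E t))"

definition normal_contraction :: "(real \<Rightarrow> real) \<Rightarrow> bool" where
  "normal_contraction \<phi> \<longleftrightarrow> 1-lipschitz_on UNIV \<phi> \<and> \<phi> 0 = 0"

definition normal_contraction_property :: "'a measure \<Rightarrow> (('a \<Rightarrow> real) \<Rightarrow> ennreal) \<Rightarrow> bool" where
  "normal_contraction_property M E \<longleftrightarrow>
     (\<forall>\<phi>. normal_contraction \<phi> \<longrightarrow> (\<forall>f\<in>L2 M. E (\<phi> \<circ> f) \<le> E f))"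

end

theory Submission
  imports Defs
begin

text \<open>
  The forward implication is the case $\phi(y) = -y$. For the converse, let $E(-f) = E(f)$.

  Suppose that for nondecreasing $p, q$ vanishing at $0$ the form satisfies
  $$E(w + p\circ f) + E(w + q\circ f) \le E(w + p\circ f + q\circ f) + E(w) \qquad\mbox{for all } w. \quad (S)$$
  If $\phi$ is a normal contraction, then $p(y) = y + \phi(y)$ and $q(y) = y - \phi(y)$ are
  nondecreasing with $p + q = 2\,\mathrm{id}$. With $w = -f$ the inequality (S) becomes
  $E(\phi\circ f) + E(-\phi\circ f) \le E(f) + E(-f)$, which by symmetry is
  $2E(\phi\circ f) \le 2E(f)$. So everything rests on (S), a supermodularity of $E$ along
  comonotone directions.

  The semigroup enters only through the sets $C_\alpha = \{(f,g) : f - g \le \alpha\}$,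
  $\alpha \ge 0$. Order preservation and $L^\infty$-contraction together say that
  $T_t \times T_t$ maps $C_\alpha$ to itself. Let $z = (f,g)$ and let $Pz$ be its projection to
  $C_\alpha$. The flow from $Pz$ stays in $C_\alpha$, so its distance to $z$ is never smaller than
  at time $0$; but while its energy exceeds that of $z$, the subgradient inequality forces this
  distance to decrease. Hence the projection does not increase the energy
  (\<open>gap_projection_energy_le\<close>): moving $f$ and $g$ towards each other by $h/2$ is
  favourable, where $h = (f - g - \alpha)^+$.

  One can in fact move them by the full amount $h$, which mirrors the part of their difference above
  the gap $\alpha$ (\<open>gap_reflection_energy_le\<close>). Indeed the projection inequality, applied
  to suitable points of the grids $f - h + (k/N) h$ and $g + (j/N) h$, compares the energy increments
  along the two segments from $f - h$ to $f$ and from $g$ to $g + h$, and the comparisons telescope.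

  The reflection is exactly (S) when one of the two increments lives where the other has already
  reached its maximum. Piecewise linear $p$ and $q$ are built from bottom to top out of thin layers
  $\min((y - k\epsilon)^+, \epsilon)$, each living where all the lower ones are saturated; adding
  one layer at a time gives (S) for them (\<open>supermodular_along_layered\<close>).
  Interpolating $\phi$ on finer and finer grids and lower semicontinuity finish the proof.
\<close>

section \<open>Square-integrable functions\<close>

lemma L2_measurable [dest]: "f \<in> L2 M \<Longrightarrow> f \<in> borel_measurable M"
  by (simp add: L2_def)

lemma L2_integrable_square: "f \<in> L2 M \<Longrightarrow> integrable M (\<lambda>x. (f x)\<^sup>2)"
  by (simp add: L2_def)

lemma L2_dominated:
  assumes g: "g \<in> L2 M" and f: "f \<in> borel_measurable M" and le: "\<And>x. \<bar>f x\<bar> \<le> \<bar>g x\<bar>"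
  shows "f \<in> L2 M"
proof -
  have "integrable M (\<lambda>x. (f x)\<^sup>2)"
  proof (rule Bochner_Integration.integrable_bound[OF L2_integrable_square[OF g]])
    show "(\<lambda>x. (f x)\<^sup>2) \<in> borel_measurable M" using f by measurable
    show "AE x in M. norm ((f x)\<^sup>2) \<le> norm ((g x)\<^sup>2)"
      using le by (auto simp: abs_le_square_iff)
  qed
  then show ?thesis using f by (simp add: L2_def)
qed

lemma L2_mult_integrable:
  assumes f: "f \<in> L2 M" and g: "g \<in> L2 M"
  shows "integrable M (\<lambda>x. f x * g x)"
proof (rule Bochner_Integration.integrable_bound)
  show "integrable M (\<lambda>x. (f x)\<^sup>2 + (g x)\<^sup>2)"
    using f g by (intro Bochner_Integration.integrable_add L2_integrable_square)
  show "(\<lambda>x. f x * g x) \<in> borel_measurable M"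
    using f g by (intro borel_measurable_times L2_measurable)
  have "\<bar>f x * g x\<bar> \<le> (f x)\<^sup>2 + (g x)\<^sup>2" for x
    using sum_squares_bound[of "\<bar>f x\<bar>" "\<bar>g x\<bar>"] mult_nonneg_nonneg[of "\<bar>f x\<bar>" "\<bar>g x\<bar>"]
    unfolding abs_mult power2_abs by linarith
  then show "AE x in M. norm (f x * g x) \<le> norm ((f x)\<^sup>2 + (g x)\<^sup>2)"
    by (auto intro: order_trans)
qed

lemma L2_add [intro]:
  assumes f: "f \<in> L2 M" and g: "g \<in> L2 M"
  shows "(\<lambda>x. f x + g x) \<in> L2 M"
proof -
  have "integrable M (\<lambda>x. (f x)\<^sup>2 + (g x)\<^sup>2 + 2 * (f x * g x))"
    using f g by (intro Bochner_Integration.integrable_add L2_integrable_square integrable_mult_right L2_mult_integrable)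
  then have "integrable M (\<lambda>x. (f x + g x)\<^sup>2)" by (simp add: power2_sum mult.assoc)
  then show ?thesis using L2_measurable[OF f] L2_measurable[OF g] by (simp add: L2_def)
qed

lemma L2_cmult [intro]: "f \<in> L2 M \<Longrightarrow> (\<lambda>x. c * f x) \<in> L2 M" for c :: real
  by (auto simp: L2_def power_mult_distrib)

lemma L2_uminus [intro]: "f \<in> L2 M \<Longrightarrow> (\<lambda>x. - f x) \<in> L2 M"
  using L2_cmult[of f M "-1"] by simp

lemma L2_diff [intro]:
  assumes f: "f \<in> L2 M" and g: "g \<in> L2 M"
  shows "(\<lambda>x. f x - g x) \<in> L2 M"
  using L2_add[OF f L2_uminus[OF g]] by simp

lemma L2_positive_excess [intro]:
  assumes f: "f \<in> L2 M" and "\<alpha> \<ge> 0"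
  shows "(\<lambda>x. max (f x - \<alpha>) 0) \<in> L2 M"
  using f by (rule L2_dominated) (use assms in \<open>auto intro!: borel_measurable_max borel_measurable_diff\<close>)

lemma L2_norm_nonneg [simp]: "0 \<le> L2_norm M f"
  by (simp add: L2_norm_def)

lemma L2_norm_square: "(L2_norm M f)\<^sup>2 = (\<integral>x. (f x)\<^sup>2 \<partial>M)"
  by (simp add: L2_norm_def)

lemma L2_norm_cmult: "L2_norm M (\<lambda>x. c * f x) = \<bar>c\<bar> * L2_norm M f" for c :: real
  by (simp add: L2_norm_def power_mult_distrib real_sqrt_mult)

lemma L2_norm_minus_commute: "L2_norm M (\<lambda>x. f x - g x) = L2_norm M (\<lambda>x. g x - f x)"
  by (simp add: L2_norm_def power2_commute)

lemma L2_norm_square_add: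
  assumes f: "f \<in> L2 M" and g: "g \<in> L2 M"
  shows "(L2_norm M (\<lambda>x. f x + g x))\<^sup>2 = (L2_norm M f)\<^sup>2 + 2 * L2_inner M f g + (L2_norm M g)\<^sup>2"
proof -
  have "(\<integral>x. (f x + g x)\<^sup>2 \<partial>M) = (\<integral>x. (f x)\<^sup>2 + (2 * (f x * g x) + (g x)\<^sup>2) \<partial>M)"
    by (simp add: power2_sum algebra_simps)
  also have "\<dots> = (\<integral>x. (f x)\<^sup>2 \<partial>M) + ((\<integral>x. 2 * (f x * g x) \<partial>M) + (\<integral>x. (g x)\<^sup>2 \<partial>M))"
    using f g by (simp add: L2_integrable_square L2_mult_integrable)
  finally show ?thesis by (simp add: L2_norm_square L2_inner_def)
qed

lemma L2_norm_square_diff: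
  assumes f: "f \<in> L2 M" and g: "g \<in> L2 M"
  shows "(L2_norm M (\<lambda>x. f x - g x))\<^sup>2 = (L2_norm M f)\<^sup>2 - 2 * L2_inner M f g + (L2_norm M g)\<^sup>2"
  using L2_norm_square_add[OF f L2_uminus[OF g]]
  by (simp add: L2_inner_def L2_norm_square)

lemma L2_inner_add_left:
  assumes "f \<in> L2 M" "g \<in> L2 M" "h \<in> L2 M"
  shows "L2_inner M (\<lambda>x. f x + g x) h = L2_inner M f h + L2_inner M g h"
  using assms by (simp add: L2_inner_def algebra_simps L2_mult_integrable)

lemma L2_inner_cmult_left: "L2_inner M (\<lambda>x. c * f x) g = c * L2_inner M f g" for c :: real
  by (simp add: L2_inner_def mult.assoc)

lemma L2_inner_commute: "L2_inner M f g = L2_inner M g f"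
  by (simp add: L2_inner_def mult.commute)

lemma L2_Cauchy_Schwarz:
  assumes f: "f \<in> L2 M" and g: "g \<in> L2 M"
  shows "\<bar>L2_inner M f g\<bar> \<le> L2_norm M f * L2_norm M g"
proof -
  define a b c where "a = (L2_norm M f)\<^sup>2" and "b = L2_inner M f g" and "c = (L2_norm M g)\<^sup>2"
  have quad: "0 \<le> a * s\<^sup>2 + 2 * s * t * b + c * t\<^sup>2" for s t
  proof -
    have "0 \<le> (L2_norm M (\<lambda>x. s * f x + t * g x))\<^sup>2" by simp
    also have "\<dots> = a * s\<^sup>2 + 2 * s * t * b + c * t\<^sup>2"
      using f g by (subst L2_norm_square_add)
        (auto simp: L2_norm_cmult L2_inner_def a_def b_def c_def power_mult_distrib algebra_simps)
    finally show ?thesis .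
  qed
  have ac: "a \<ge> 0" "c \<ge> 0" by (simp_all add: a_def c_def)
  have "b\<^sup>2 \<le> a * c"
  proof (cases "a = 0")
    case True
    have "b = 0"
    proof (rule ccontr)
      assume "b \<noteq> 0"
      have "2 * (- (c+1) / (2*b)) * 1 * b = - (c + 1)"
        using \<open>b \<noteq> 0\<close> by (simp add: field_simps)
      with quad[of "- (c+1) / (2*b)" 1] True show False by simp
    qed
    then show ?thesis using ac by simp
  next
    case False
    then have "a > 0" using ac by simp
    have "0 \<le> a * (- b)\<^sup>2 + 2 * (-b) * a * b + c * a\<^sup>2" using quad .
    then have "0 \<le> a * (a * c - b\<^sup>2)" by (simp add: algebra_simps power2_eq_square)
    then show ?thesis using \<open>a > 0\<close> by (simp add: zero_le_mult_iff)
  qed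
  then have "\<bar>b\<bar> \<le> sqrt (a * c)" by (intro real_le_rsqrt) simp
  then show ?thesis by (simp add: a_def b_def c_def real_sqrt_mult)
qed

lemma L2_norm_triangle:
  assumes f: "f \<in> L2 M" and g: "g \<in> L2 M"
  shows "L2_norm M (\<lambda>x. f x + g x) \<le> L2_norm M f + L2_norm M g"
proof (rule power2_le_imp_le)
  show "(L2_norm M (\<lambda>x. f x + g x))\<^sup>2 \<le> (L2_norm M f + L2_norm M g)\<^sup>2"
    using L2_Cauchy_Schwarz[OF f g] by (simp add: L2_norm_square_add[OF f g] power2_sum)
qed simp

lemma L2_norm_triangle_diff:
  assumes "f \<in> L2 M" "g \<in> L2 M" "h \<in> L2 M"
  shows "L2_norm M (\<lambda>x. f x - h x) \<le> L2_norm M (\<lambda>x. f x - g x) + L2_norm M (\<lambda>x. g x - h x)"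
  using L2_norm_triangle[OF L2_diff[of f M g] L2_diff[of g M h]] assms by simp

lemma tendsto_L2_norm_diff:
  assumes u: "eventually (\<lambda>s. u s \<in> L2 M) F" and w: "w \<in> L2 M" and f: "f \<in> L2 M"
    and lim: "((\<lambda>s. L2_norm M (\<lambda>x. u s x - w x)) \<longlongrightarrow> 0) F"
  shows "((\<lambda>s. L2_norm M (\<lambda>x. u s x - f x)) \<longlongrightarrow> L2_norm M (\<lambda>x. w x - f x)) F"
proof (rule Lim_transform)
  show "((\<lambda>s. L2_norm M (\<lambda>x. w x - f x)) \<longlongrightarrow> L2_norm M (\<lambda>x. w x - f x)) F" by simp
  show "((\<lambda>s. L2_norm M (\<lambda>x. u s x - f x) - L2_norm M (\<lambda>x. w x - f x)) \<longlongrightarrow> 0) F"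
  proof (rule Lim_null_comparison[OF _ lim], rule eventually_mono[OF u])
    fix s assume us: "u s \<in> L2 M"
    show "norm (L2_norm M (\<lambda>x. u s x - f x) - L2_norm M (\<lambda>x. w x - f x)) \<le> L2_norm M (\<lambda>x. u s x - w x)"
      using L2_norm_triangle_diff[OF us w f] L2_norm_triangle_diff[OF w us f]
      by (simp add: L2_norm_minus_commute[of M w])
  qed
qed

section \<open>Lower semicontinuity and monotonicity along curves\<close>

text \<open>
  Truncating the values at the limit value turns lower semicontinuity into genuine convergence,
  so that the sum of two energies, possibly infinite, is handled by continuity of addition.
\<close>
lemma L2_lsc_add_eventually:
  assumes lsc: "L2_lsc M E"
    and f: "f \<in> L2 M" and g: "g \<in> L2 M"
    and u: "eventually (\<lambda>s. u s \<in> L2 M) F" and v: "eventually (\<lambda>s. v s \<in> L2 M) F"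
    and ulim: "((\<lambda>s. L2_norm M (\<lambda>x. u s x - f x)) \<longlongrightarrow> 0) F"
    and vlim: "((\<lambda>s. L2_norm M (\<lambda>x. v s x - g x)) \<longlongrightarrow> 0) F"
    and c: "c < E f + E g"
  shows "eventually (\<lambda>s. c < E (u s) + E (v s)) F"
proof -
  have *: "((\<lambda>s. min (E (u s)) (E f)) \<longlongrightarrow> E f) F"
    if f: "f \<in> L2 M" and u: "eventually (\<lambda>s. u s \<in> L2 M) F"
      and ulim: "((\<lambda>s. L2_norm M (\<lambda>x. u s x - f x)) \<longlongrightarrow> 0) F" for f u
  proof (rule order_tendstoI)
    fix a assume "a < E f"
    with lsc f obtain \<delta> where \<delta>: "\<delta> > 0"
      "\<And>g. g \<in> L2 M \<Longrightarrow> L2_norm M (\<lambda>x. g x - f x) < \<delta> \<Longrightarrow> a < E g"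
      unfolding L2_lsc_def by blast
    have "eventually (\<lambda>s. L2_norm M (\<lambda>x. u s x - f x) < \<delta>) F"
      using order_tendstoD(2)[OF ulim \<delta>(1)] .
    then show "eventually (\<lambda>s. a < min (E (u s)) (E f)) F"
      using u by eventually_elim (use \<open>a < E f\<close> \<delta>(2) in auto)
  qed (auto simp: min_less_iff_disj)
  have "((\<lambda>s. min (E (u s)) (E f) + min (E (v s)) (E g)) \<longlongrightarrow> E f + E g) F"
    by (intro tendsto_add * assms)
  from order_tendstoD(1)[OF this c] show ?thesis
    by (rule eventually_mono) (erule less_le_trans, intro add_mono min.cobounded1)
qed

lemma L2_lsc_add_le:
  assumes lsc: "L2_lsc M E" and F: "F \<noteq> bot"
    and f: "f \<in> L2 M" and g: "g \<in> L2 M"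
    and u: "eventually (\<lambda>s. u s \<in> L2 M) F" and v: "eventually (\<lambda>s. v s \<in> L2 M) F"
    and ulim: "((\<lambda>s. L2_norm M (\<lambda>x. u s x - f x)) \<longlongrightarrow> 0) F"
    and vlim: "((\<lambda>s. L2_norm M (\<lambda>x. v s x - g x)) \<longlongrightarrow> 0) F"
    and le: "eventually (\<lambda>s. E (u s) + E (v s) \<le> c) F"
  shows "E f + E g \<le> c"
proof (rule ccontr)
  assume "\<not> ?thesis"
  then have "c < E f + E g" by simp
  from eventually_conj[OF L2_lsc_add_eventually[where u=u and v=v, OF lsc f g u v ulim vlim this] le] 
  have "eventually (\<lambda>s. False) F" by (rule eventually_mono) auto
  with F show False by simp
qed

text \<open>
  The flow has only right derivatives, so the distance to a fixed function is known to decrease only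
  immediately to the right of each time. The last time at which the value does not exceed
  the initial one cannot come before \<open>b\<close>.
\<close>
lemma antimono_if_locally_right_le:
  fixes F :: "real \<Rightarrow> real"
  assumes ab: "a \<le> b" and cont: "continuous_on {a..b} F"
    and right: "\<And>t. a \<le> t \<Longrightarrow> t < b \<Longrightarrow> eventually (\<lambda>h. F (t + h) \<le> F t) (at_right 0)"
  shows "F b \<le> F a"
proof -
  define S where "S = {t\<in>{a..b}. F t \<le> F a}"
  have "closed S" unfolding S_def
    using continuous_on_closed_Collect_le[OF cont continuous_on_const] by simp
  then have "compact S"
    by (intro compact_eq_bounded_closed[THEN iffD2] conjI) 
       (auto intro!: bounded_subset[OF bounded_closed_interval[of a b]] simp: S_def)
  moreover have "S \<noteq> {}" using ab by (auto simp: S_def)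
  ultimately obtain t where t: "t \<in> S" "\<And>s. s \<in> S \<Longrightarrow> s \<le> t"
    using compact_attains_sup by metis
  have "t = b"
  proof (rule ccontr)
    assume "t \<noteq> b"
    with t have tb: "a \<le> t" "t < b" by (auto simp: S_def)
    have "eventually (\<lambda>h. h < b - t) (at_right (0::real))"
      using tb by (intro eventually_at_rightI[of 0 "b - t"]) auto
    moreover have "eventually (\<lambda>h. h > (0::real)) (at_right 0)" by (rule eventually_at_right_less)
    ultimately have "eventually (\<lambda>h. F (t + h) \<le> F t \<and> h < b - t \<and> h > 0) (at_right 0)"
      using right[OF tb] by eventually_elim auto
    then obtain h where "F (t + h) \<le> F t" "h < b - t" "h > 0"
      using eventually_happens'[of "at_right (0::real)"] by force
    with t tb have "t + h \<in> S" by (auto simp: S_def)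
    with t(2) \<open>h > 0\<close> show False by force
  qed
  with t show ?thesis by (auto simp: S_def)
qed

section \<open>Projection onto pairs with bounded gap\<close>

lemma L2_convex_finite:
  assumes conv: "L2_convex M E" and f: "f \<in> L2 M" "E f < \<infinity>" and g: "g \<in> L2 M" "E g < \<infinity>"
    and s: "0 \<le> s" "s \<le> (1::real)"
  shows "E (\<lambda>x. (1 - s) * f x + s * g x) < \<infinity>"
proof -
  have "E (\<lambda>x. (1 - s) * f x + s * g x) \<le> ennreal (1 - s) * E f + ennreal s * E g"
    using conv f g s unfolding L2_convex_def by simp
  also have "\<dots> < \<infinity>" using f g by (auto simp: ennreal_mult_less_top)
  finally show ?thesis .
qed

text \<open>
  Replacing \<open>f\<close> by \<open>max f g\<close> only increases \<open>T f\<close>, by order preservation, and puts \<open>f\<close>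
  within uniform distance \<open>\<alpha>\<close> of \<open>g\<close>. Adding the constant \<open>\<alpha>\<close> to \<open>g\<close>
  instead would leave \<open>L2 M\<close> when the measure is infinite.
\<close>
lemma gap_preserving:
  assumes ord: "order_preserving M T" and con: "Linf_contraction M T"
    and f: "f \<in> L2 M" and g: "g \<in> L2 M" and \<alpha>: "0 \<le> \<alpha>"
    and gap: "AE x in M. f x - g x \<le> \<alpha>"
  shows "AE x in M. T f x - T g x \<le> \<alpha>"
proof -
  define k where "k = (\<lambda>x. max (f x) (g x))"
  have "k = (\<lambda>x. g x + max (f x - g x - 0) 0)" by (auto simp: k_def)
  then have k: "k \<in> L2 M" using L2_add[OF g L2_positive_excess[OF L2_diff[OF f g], of 0]] by simp
  have "AE x in M. f x \<le> k x" by (simp add: k_def)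
  then have le: "AE x in M. T f x \<le> T k x" using ord f k unfolding order_preserving_def by blast
  have "Linf_norm M (\<lambda>x. k x - g x) \<le> ennreal \<alpha>" unfolding Linf_norm_def
  proof (rule esssup_I)
    show "(\<lambda>x. ennreal \<bar>k x - g x\<bar>) \<in> borel_measurable M"
      using L2_measurable[OF k] L2_measurable[OF g] by measurable
    show "AE x in M. ennreal \<bar>k x - g x\<bar> \<le> ennreal \<alpha>"
      using gap by eventually_elim (use \<alpha> in \<open>auto simp: k_def intro!: ennreal_leI\<close>)
  qed
  then have "Linf_norm M (\<lambda>x. T k x - T g x) \<le> ennreal \<alpha>"
    using con k g unfolding Linf_contraction_def by (blast intro: order_trans)
  moreover have "AE x in M. ennreal \<bar>T k x - T g x\<bar> \<le> Linf_norm M (\<lambda>x. T k x - T g x)"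
    unfolding Linf_norm_def by (rule esssup_AE)
  ultimately have "AE x in M. ennreal \<bar>T k x - T g x\<bar> \<le> ennreal \<alpha>"
    by (auto elim!: eventually_mono intro: order_trans)
  with le show ?thesis by eventually_elim (use \<alpha> in auto)
qed

text \<open>
  The angle at a metric projection onto a convex set is at least a right angle. It is tested by
  moving from \<open>w\<close> towards \<open>g\<close>; as \<open>w\<close> itself may have infinite energy, the move
  starts from points of the domain close to \<open>w\<close>.
\<close>
lemma nearest_in_closure_obtuse:
  assumes conv: "L2_convex M E" and near: "nearest_in_closure M (effective_domain M E) f w"
    and f: "f \<in> L2 M" and g: "g \<in> effective_domain M E"
  shows "(L2_norm M (\<lambda>x. f x - w x))\<^sup>2 + (L2_norm M (\<lambda>x. w x - g x))\<^sup>2 \<le> (L2_norm M (\<lambda>x. f x - g x))\<^sup>2"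
proof -
  have w: "w \<in> L2 M" and dense: "\<And>e. e > 0 \<Longrightarrow> \<exists>k\<in>effective_domain M E. L2_norm M (\<lambda>x. k x - w x) < e"
    and min: "\<And>k. k \<in> effective_domain M E \<Longrightarrow> L2_norm M (\<lambda>x. f x - w x) \<le> L2_norm M (\<lambda>x. f x - k x)"
    using near by (auto simp: nearest_in_closure_def)
  have gL: "g \<in> L2 M" and gE: "E g < \<infinity>" using g by (auto simp: effective_domain_def)
  define a b where "a = (\<lambda>x. f x - w x)" and "b = (\<lambda>x. g x - w x)"
  have a: "a \<in> L2 M" and b: "b \<in> L2 M" using f gL w by (auto simp: a_def b_def)
  have le: "L2_norm M a \<le> L2_norm M (\<lambda>x. a x - s * b x)" if s: "0 < s" "s \<le> 1" for s
  proof (rule field_le_epsilon)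
    fix e :: real assume "e > 0"
    then obtain k where k: "k \<in> effective_domain M E" and ke: "L2_norm M (\<lambda>x. k x - w x) < e"
      using dense by blast
    have kL: "k \<in> L2 M" and kE: "E k < \<infinity>" using k by (auto simp: effective_domain_def)
    have "E (\<lambda>x. (1 - s) * k x + s * g x) < \<infinity>"
      using s by (intro L2_convex_finite[where E=E and M=M, OF conv kL kE gL gE]) auto
    then have "(\<lambda>x. (1 - s) * k x + s * g x) \<in> effective_domain M E"
      using kL gL by (auto simp: effective_domain_def)
    from min[OF this]
    have "L2_norm M a \<le> L2_norm M (\<lambda>x. f x - ((1 - s) * k x + s * g x))" by (simp add: a_def)
    also have "(\<lambda>x. f x - ((1 - s) * k x + s * g x)) = (\<lambda>x. (a x - s * b x) + (- (1 - s)) * (k x - w x))"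
      by (auto simp: a_def b_def algebra_simps)
    also have "L2_norm M \<dots> \<le> L2_norm M (\<lambda>x. a x - s * b x) + L2_norm M (\<lambda>x. (- (1 - s)) * (k x - w x))"
      by (intro L2_norm_triangle L2_diff L2_cmult a b kL w)
    also have "L2_norm M (\<lambda>x. (- (1 - s)) * (k x - w x)) = (1 - s) * L2_norm M (\<lambda>x. k x - w x)"
      using s by (subst L2_norm_cmult) auto
    also have "\<dots> \<le> 1 * e" using s ke by (intro mult_mono) auto
    finally show "L2_norm M a \<le> L2_norm M (\<lambda>x. a x - s * b x) + e" by simp
  qed
  have ineq: "2 * L2_inner M a b \<le> s * (L2_norm M b)\<^sup>2" if s: "0 < s" "s \<le> 1" for s
  proof -
    have "(L2_norm M a)\<^sup>2 \<le> (L2_norm M (\<lambda>x. a x - s * b x))\<^sup>2"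
      using le[OF s] by (intro power_mono) auto
    also have "\<dots> = (L2_norm M a)\<^sup>2 - 2 * (s * L2_inner M a b) + s\<^sup>2 * (L2_norm M b)\<^sup>2"
      by (subst L2_norm_square_diff[OF a L2_cmult[OF b]])
        (simp add: L2_norm_cmult power_mult_distrib L2_inner_commute[of M a] L2_inner_cmult_left)
    finally have "s * (2 * L2_inner M a b) \<le> s * (s * (L2_norm M b)\<^sup>2)"
      by (simp add: power2_eq_square algebra_simps)
    then show ?thesis using s by simp
  qed
  have "2 * L2_inner M a b \<le> 0"
  proof (rule tendsto_lowerbound)
    show "((\<lambda>s. s * (L2_norm M b)\<^sup>2) \<longlongrightarrow> 0) (at_right 0)" by (auto intro!: tendsto_eq_intros)
    show "eventually (\<lambda>s. 2 * L2_inner M a b \<le> s * (L2_norm M b)\<^sup>2) (at_right 0)"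
      using ineq by (intro eventually_at_rightI[of 0 1]) auto
  qed simp
  moreover have "(L2_norm M (\<lambda>x. f x - g x))\<^sup>2 = (L2_norm M a)\<^sup>2 - 2 * L2_inner M a b + (L2_norm M b)\<^sup>2"
    using L2_norm_square_diff[OF a b] by (simp add: a_def b_def)
  ultimately show ?thesis
    by (simp add: a_def b_def L2_norm_minus_commute[of M w])
qed

text \<open>
  The derivative of the squared distance from \<open>u t\<close> to \<open>f\<close> is \<open>2 \<langle>- v, u t - f\<rangle>\<close>
  for a subgradient \<open>v\<close> at \<open>u t\<close>, and the subgradient inequality bounds it by twice the
  energy difference.
\<close>
lemma gradient_flow_distance_derivative:
  assumes flow: "gradient_flow M E f0 u" and t: "t > 0"
    and f: "f \<in> L2 M" and fE: "E f < \<infinity>"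
  shows "E (u t) < \<infinity>"
    and "\<exists>d \<le> 2 * (enn2real (E f) - enn2real (E (u t))).
      ((\<lambda>h. ((L2_norm M (\<lambda>x. u (t + h) x - f x))\<^sup>2 - (L2_norm M (\<lambda>x. u t x - f x))\<^sup>2) / h) \<longlongrightarrow> d) (at_right 0)"
proof -
  have u: "u s \<in> L2 M" if "s \<ge> 0" for s using flow that by (auto simp: gradient_flow_def)
  obtain v where v: "v \<in> subdifferential M E (u t)" and
    lim: "((\<lambda>h. L2_norm M (\<lambda>x. (u (t + h) x - u t x) / h - (- v x))) \<longlongrightarrow> 0) (at_right 0)"
    using flow t by (auto simp: gradient_flow_def)
  have ut: "u t \<in> L2 M" using u t by simp
  have vL: "v \<in> L2 M" and sub: "enn2ereal (E (u t)) + ereal (L2_inner M v (\<lambda>x. f x - u t x)) \<le> enn2ereal (E f)"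
    using v f by (auto simp: subdifferential_def)
  obtain b where b: "E f = ennreal b" "b \<ge> 0" using fE by (cases "E f") auto
  show fin: "E (u t) < \<infinity>"
    using sub b by (cases "E (u t)") (auto simp: enn2ereal_ennreal)
  then obtain a where a: "E (u t) = ennreal a" "a \<ge> 0" by (cases "E (u t)") auto
  have sub': "a + L2_inner M v (\<lambda>x. f x - u t x) \<le> b"
    using sub a b by (simp add: enn2ereal_ennreal)
  define k where "k = (\<lambda>x. u t x - f x)"
  have k: "k \<in> L2 M" using ut f by (auto simp: k_def)
  define q where "q = (\<lambda>h x. (1 / h) * (u (t + h) x - u t x))"
  have ev: "eventually (\<lambda>h. h > (0::real)) (at_right 0)" by (rule eventually_at_right_less)
  have q: "q h \<in> L2 M" if "h > 0" for h
    unfolding q_def by (intro L2_cmult L2_diff u) (use t that in auto)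
  have qlim: "((\<lambda>h. L2_norm M (\<lambda>x. q h x - (- v x))) \<longlongrightarrow> 0) (at_right 0)"
    using lim by (simp add: q_def)
  have zero: "(\<lambda>x. 0) \<in> L2 M" by (simp add: L2_def)
  have qn: "((\<lambda>h. L2_norm M (q h)) \<longlongrightarrow> L2_norm M (\<lambda>x. - v x)) (at_right 0)"
    using tendsto_L2_norm_diff[OF eventually_mono[OF ev q] L2_uminus[OF vL] zero qlim] by simp
  have qi: "((\<lambda>h. L2_inner M (q h) k) \<longlongrightarrow> - L2_inner M v k) (at_right 0)"
  proof (rule LIM_zero_cancel, rule Lim_null_comparison)
    show "((\<lambda>h. L2_norm M (\<lambda>x. q h x - (- v x)) * L2_norm M k) \<longlongrightarrow> 0) (at_right 0)"
      using tendsto_mult[OF qlim tendsto_const] by simp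
    show "eventually (\<lambda>h. norm (L2_inner M (q h) k - - L2_inner M v k) \<le> L2_norm M (\<lambda>x. q h x - (- v x)) * L2_norm M k) (at_right 0)"
      using ev
    proof eventually_elim
      case (elim h)
      have "L2_inner M (q h) k - - L2_inner M v k = L2_inner M (\<lambda>x. q h x - (- v x)) k"
        using L2_inner_add_left[OF q[OF elim] vL k] by simp
      then show ?case using L2_Cauchy_Schwarz[OF L2_diff[OF q[OF elim] L2_uminus[OF vL]] k] by simp
    qed
  qed
  have "((\<lambda>h. 2 * L2_inner M (q h) k + h * (L2_norm M (q h))\<^sup>2) \<longlongrightarrow> 2 * (- L2_inner M v k) + 0 * (L2_norm M (\<lambda>x. - v x))\<^sup>2) (at_right 0)"
    by (intro tendsto_intros qn qi)
  then have "((\<lambda>h. 2 * L2_inner M (q h) k + h * (L2_norm M (q h))\<^sup>2) \<longlongrightarrow> - 2 * L2_inner M v k) (at_right 0)"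
    by simp
  moreover have "eventually (\<lambda>h. 2 * L2_inner M (q h) k + h * (L2_norm M (q h))\<^sup>2 =
     ((L2_norm M (\<lambda>x. u (t + h) x - f x))\<^sup>2 - (L2_norm M (\<lambda>x. u t x - f x))\<^sup>2) / h) (at_right 0)"
    using ev
  proof eventually_elim
    case (elim h)
    have "(\<lambda>x. u (t + h) x - f x) = (\<lambda>x. k x + h * q h x)"
      using elim by (auto simp: k_def q_def)
    then have "(L2_norm M (\<lambda>x. u (t + h) x - f x))\<^sup>2 = (L2_norm M k)\<^sup>2 + 2 * (h * L2_inner M (q h) k) + h\<^sup>2 * (L2_norm M (q h))\<^sup>2"
      using L2_norm_square_add[OF k L2_cmult[OF q[OF elim], of h]]
      by (simp add: L2_norm_cmult power_mult_distrib L2_inner_commute[of M k] L2_inner_cmult_left)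
    then show ?case using elim by (simp add: k_def field_simps power2_eq_square)
  qed
  ultimately have "((\<lambda>h. ((L2_norm M (\<lambda>x. u (t + h) x - f x))\<^sup>2 - (L2_norm M (\<lambda>x. u t x - f x))\<^sup>2) / h) \<longlongrightarrow> - 2 * L2_inner M v k) (at_right 0)"
    by (rule Lim_transform_eventually)
  moreover have "- L2_inner M v k = L2_inner M v (\<lambda>x. f x - u t x)"
    by (simp add: k_def L2_inner_def algebra_simps flip: Bochner_Integration.integral_minus)
  then have "- 2 * L2_inner M v k \<le> 2 * (enn2real (E f) - enn2real (E (u t)))"
    using sub' a b by simp
  ultimately show "\<exists>d \<le> 2 * (enn2real (E f) - enn2real (E (u t))).
      ((\<lambda>h. ((L2_norm M (\<lambda>x. u (t + h) x - f x))\<^sup>2 - (L2_norm M (\<lambda>x. u t x - f x))\<^sup>2) / h) \<longlongrightarrow> d) (at_right 0)"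
    by blast
qed

text \<open>
  The two functions on the left form the projection of \<open>(f, g)\<close> onto the pairs with gap at
  most \<open>\<alpha>\<close>. If their energy were larger, the flow starting at them would initially have
  more energy than \<open>(f, g)\<close> and would strictly approach \<open>(f, g)\<close>, although it
  never leaves the set onto which \<open>(f, g)\<close> was projected.
\<close>
lemma gap_projection_energy_le:
  assumes D: "nonbilinear_dirichlet_form M E"
    and f: "f \<in> L2 M" and g: "g \<in> L2 M" and \<alpha>: "0 \<le> \<alpha>"
  shows "E (\<lambda>x. f x - max (f x - g x - \<alpha>) 0 / 2) + E (\<lambda>x. g x + max (f x - g x - \<alpha>) 0 / 2) \<le> E f + E g"
proof (rule ccontr)
  define h where "h = (\<lambda>x. (1/2) * max (f x - g x - \<alpha>) 0)"
  define f' g' where "f' = (\<lambda>x. f x - h x)" and "g' = (\<lambda>x. g x + h x)"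
  assume "\<not> ?thesis"
  then have less: "E f + E g < E f' + E g'" by (simp add: f'_def g'_def h_def)
  then have "E f + E g < \<infinity>" using less_le_trans top_greatest by (metis infinity_ennreal_def)
  then have fE: "E f < \<infinity>" and gE: "E g < \<infinity>" by auto
  have lsc: "L2_lsc M E" and conv: "L2_convex M E" and wp: "well_posed M E"
    and T: "\<And>t. t \<ge> 0 \<Longrightarrow> order_preserving M (flow_semigroup M E t)" 
      "\<And>t. t \<ge> 0 \<Longrightarrow> Linf_contraction M (flow_semigroup M E t)"
    using D by (auto simp: nonbilinear_dirichlet_form_def)
  have h: "h \<in> L2 M" unfolding h_def by (intro L2_cmult L2_positive_excess L2_diff f g \<alpha>)
  have f': "f' \<in> L2 M" and g': "g' \<in> L2 M" using f g h by (auto simp: f'_def g'_def)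
  define u v where "u = (\<lambda>t. flow_semigroup M E t f')" and "v = (\<lambda>t. flow_semigroup M E t g')"
  have flow: "gradient_flow M E k (\<lambda>t. flow_semigroup M E t k)" if "k \<in> L2 M" for k
  proof -
    have "\<exists>u. gradient_flow M E k u" using wp that by (auto simp: well_posed_def)
    then have "gradient_flow M E k (SOME u. gradient_flow M E k u)" by (rule someI_ex)
    then show ?thesis by (simp add: flow_semigroup_def)
  qed
  have uflow: "gradient_flow M E f' u" and vflow: "gradient_flow M E g' v"
    using flow f' g' by (auto simp: u_def v_def)
  have u: "u t \<in> L2 M" and v: "v t \<in> L2 M" if "t \<ge> 0" for t
    using uflow vflow that by (auto simp: gradient_flow_def)
  have gap: "AE x in M. u t x - v t x \<le> \<alpha>" if "t \<ge> 0" for t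
    unfolding u_def v_def
    by (rule gap_preserving[OF T[OF that] f' g' \<alpha>]) (use \<alpha> in \<open>auto simp: f'_def g'_def h_def max_def field_simps\<close>)
  define F where "F = (\<lambda>t. (L2_norm M (\<lambda>x. u t x - f x))\<^sup>2 + (L2_norm M (\<lambda>x. v t x - g x))\<^sup>2)"
  \<comment> \<open>No pair with gap at most \<open>\<alpha>\<close> is closer to \<open>(f, g)\<close> than \<open>(f', g')\<close>.\<close>
  have F_ge: "2 * (L2_norm M h)\<^sup>2 \<le> F t" if t: "t \<ge> 0" for t
  proof -
    have int: "integrable M (\<lambda>x. (u t x - f x)\<^sup>2)" "integrable M (\<lambda>x. (v t x - g x)\<^sup>2)" "integrable M (\<lambda>x. (h x)\<^sup>2)"
      using u[OF t] v[OF t] f g h by (auto intro!: L2_integrable_square)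
    have "(\<integral>x. 2 * (h x)\<^sup>2 \<partial>M) \<le> (\<integral>x. (u t x - f x)\<^sup>2 + (v t x - g x)\<^sup>2 \<partial>M)"
    proof (rule integral_mono_AE)
      show "AE x in M. 2 * (h x)\<^sup>2 \<le> (u t x - f x)\<^sup>2 + (v t x - g x)\<^sup>2"
        using gap[OF t]
      proof eventually_elim
        case (elim x)
        show ?case
        proof (cases "h x = 0")
          case False
          then have "h x > 0" "f x - g x = \<alpha> + 2 * h x" by (auto simp: h_def max_def split: if_splits)
          then have *: "2 * h x \<le> (f x - u t x) + (v t x - g x)" "0 < h x" using elim by auto
          then have "(2 * h x)\<^sup>2 \<le> ((f x - u t x) + (v t x - g x))\<^sup>2" by (intro power_mono) auto
          also have "\<dots> \<le> 2 * ((f x - u t x)\<^sup>2 + (v t x - g x)\<^sup>2)"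
            using sum_squares_bound[of "f x - u t x" "v t x - g x"] by (simp add: power2_sum)
          finally show ?thesis by (simp add: power2_commute)
        qed simp
      qed
    qed (use int in auto)
    then show ?thesis using int by (simp add: F_def L2_norm_square)
  qed
  obtain w1 w2 where near: "nearest_in_closure M (effective_domain M E) f' w1" "nearest_in_closure M (effective_domain M E) g' w2"
    and wlim: "((\<lambda>t. L2_norm M (\<lambda>x. u t x - w1 x)) \<longlongrightarrow> 0) (at_right 0)" "((\<lambda>t. L2_norm M (\<lambda>x. v t x - w2 x)) \<longlongrightarrow> 0) (at_right 0)"
    using uflow vflow by (auto simp: gradient_flow_def)
  then have w: "w1 \<in> L2 M" "w2 \<in> L2 M" by (auto simp: nearest_in_closure_def)
  have ev0: "eventually (\<lambda>t. t \<ge> (0::real)) (at_right 0)"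
    using eventually_at_right_less[of "0::real"] by (rule eventually_mono) simp
  have evu: "eventually (\<lambda>t. u t \<in> L2 M) (at_right 0)" and evv: "eventually (\<lambda>t. v t \<in> L2 M) (at_right 0)"
    using ev0 u v by (auto elim!: eventually_mono)
  have Flim: "(F \<longlongrightarrow> (L2_norm M (\<lambda>x. w1 x - f x))\<^sup>2 + (L2_norm M (\<lambda>x. w2 x - g x))\<^sup>2) (at_right 0)"
    unfolding F_def by (intro tendsto_intros tendsto_L2_norm_diff evu evv w wlim f g)
  \<comment> \<open>The flow starts at the projections \<open>w1\<close>, \<open>w2\<close> of \<open>f'\<close>, \<open>g'\<close> onto the closure
    of the domain. The pair \<open>(w1, w2)\<close> is a limit of pairs with small gap, so it is at least as far
    from \<open>(f, g)\<close> as \<open>(f', g')\<close>; since \<open>f\<close>, \<open>g\<close> lie in the domain, the obtuse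
    angle then leaves no room between \<open>(w1, w2)\<close> and \<open>(f', g')\<close>.\<close>
  have limge: "2 * (L2_norm M h)\<^sup>2 \<le> (L2_norm M (\<lambda>x. w1 x - f x))\<^sup>2 + (L2_norm M (\<lambda>x. w2 x - g x))\<^sup>2"
    by (rule tendsto_lowerbound[OF Flim eventually_mono[OF ev0 F_ge]]) simp_all
  have dom: "f \<in> effective_domain M E" "g \<in> effective_domain M E"
    using f g fE gE by (auto simp: effective_domain_def)
  have hn: "L2_norm M (\<lambda>x. f' x - f x) = L2_norm M h" "L2_norm M (\<lambda>x. g' x - g x) = L2_norm M h"
    by (simp_all add: f'_def g'_def L2_norm_def)
  have pyth: "(L2_norm M (\<lambda>x. f' x - w1 x))\<^sup>2 + (L2_norm M (\<lambda>x. w1 x - f x))\<^sup>2 \<le> (L2_norm M h)\<^sup>2"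
     "(L2_norm M (\<lambda>x. g' x - w2 x))\<^sup>2 + (L2_norm M (\<lambda>x. w2 x - g x))\<^sup>2 \<le> (L2_norm M h)\<^sup>2"
    using nearest_in_closure_obtuse[OF conv near(1) f' dom(1)] nearest_in_closure_obtuse[OF conv near(2) g' dom(2)] 
    by (simp_all add: hn)
  have "(L2_norm M (\<lambda>x. f' x - w1 x))\<^sup>2 + (L2_norm M (\<lambda>x. g' x - w2 x))\<^sup>2 \<le> 0"
    using pyth limge by linarith
  then have z: "L2_norm M (\<lambda>x. f' x - w1 x) = 0" "L2_norm M (\<lambda>x. g' x - w2 x) = 0"
    by (simp_all add: sum_power2_le_zero_iff)
  have ulim: "((\<lambda>t. L2_norm M (\<lambda>x. u t x - f' x)) \<longlongrightarrow> 0) (at_right 0)"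
    using tendsto_L2_norm_diff[OF evu w(1) f' wlim(1)] z by (simp add: L2_norm_minus_commute[of M w1])
  have vlim: "((\<lambda>t. L2_norm M (\<lambda>x. v t x - g' x)) \<longlongrightarrow> 0) (at_right 0)"
    using tendsto_L2_norm_diff[OF evv w(2) g' wlim(2)] z by (simp add: L2_norm_minus_commute[of M w2])
  have Flim': "(F \<longlongrightarrow> 2 * (L2_norm M h)\<^sup>2) (at_right 0)"
    using tendsto_add[OF tendsto_power[OF tendsto_L2_norm_diff[OF evu f' f ulim], of 2]
        tendsto_power[OF tendsto_L2_norm_diff[OF evv g' g vlim], of 2]]
    by (simp add: F_def hn)
  obtain \<delta> where \<delta>: "\<delta> > 0" and high: "\<And>t. 0 < t \<Longrightarrow> t < \<delta> \<Longrightarrow> E f + E g < E (u t) + E (v t)"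
    using L2_lsc_add_eventually[OF lsc f' g' evu evv ulim vlim less]
    by (auto simp: eventually_at_right_field)
  have decr: "eventually (\<lambda>s. F (t + s) < F t) (at_right 0)" if t: "0 < t" "t < \<delta>" for t
  proof -
    note du = gradient_flow_distance_derivative[OF uflow t(1) f fE]
    note dv = gradient_flow_distance_derivative[OF vflow t(1) g gE]
    have "enn2real (E f) + enn2real (E g) < enn2real (E (u t)) + enn2real (E (v t))"
      using high[OF t] fE gE du(1) dv(1)
      by (cases "E f"; cases "E g"; cases "E (u t)"; cases "E (v t)") (auto simp: ennreal_less_iff simp flip: ennreal_plus)
    then obtain d1 d2 where d: "d1 + d2 < 0" and
      l: "((\<lambda>h. ((L2_norm M (\<lambda>x. u (t + h) x - f x))\<^sup>2 - (L2_norm M (\<lambda>x. u t x - f x))\<^sup>2) / h) \<longlongrightarrow> d1) (at_right 0)"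
      "((\<lambda>h. ((L2_norm M (\<lambda>x. v (t + h) x - g x))\<^sup>2 - (L2_norm M (\<lambda>x. v t x - g x))\<^sup>2) / h) \<longlongrightarrow> d2) (at_right 0)"
      using du(2) dv(2) by (smt (verit))
    have "((\<lambda>s. (F (t + s) - F t) / s) \<longlongrightarrow> d1 + d2) (at_right 0)"
      using tendsto_add[OF l] by (simp add: F_def add_divide_distrib diff_divide_distrib algebra_simps)
    from order_tendstoD(2)[OF this d] eventually_at_right_less[of "0::real"]
    show ?thesis by eventually_elim (auto simp: divide_less_0_iff)
  qed
  have contF: "isCont F t" if "t > 0" for t
  proof -
    have ev: "eventually (\<lambda>s. s \<ge> 0) (at t)"
      using eventually_at_in_open'[of "{0<..}" t] that by (auto elim!: eventually_mono)
    have "((\<lambda>s. L2_norm M (\<lambda>x. u s x - u t x)) \<longlongrightarrow> 0) (at t)" "((\<lambda>s. L2_norm M (\<lambda>x. v s x - v t x)) \<longlongrightarrow> 0) (at t)"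
      using uflow vflow that by (auto simp: gradient_flow_def)
    then show ?thesis unfolding isCont_def F_def
      using that by (intro tendsto_intros tendsto_L2_norm_diff f g eventually_mono[OF ev] u v) auto
  qed
  define b where "b = \<delta> / 2"
  have b: "0 < b" "b < \<delta>" using \<delta> by (auto simp: b_def)
  have "F b \<le> F a" if a: "0 < a" "a \<le> b" for a
  proof (rule antimono_if_locally_right_le[OF a(2)])
    show "continuous_on {a..b} F" using a by (intro continuous_at_imp_continuous_on ballI contF) auto
    show "eventually (\<lambda>s. F (t + s) \<le> F t) (at_right 0)" if "a \<le> t" "t < b" for t
      using decr[of t] a b that by (auto elim!: eventually_mono)
  qed
  then have "eventually (\<lambda>a. F b \<le> F a) (at_right 0)"
    using b by (intro eventually_at_rightI[of 0 b]) auto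
  from tendsto_lowerbound[OF Flim' this] have "F b \<le> 2 * (L2_norm M h)\<^sup>2" by simp
  moreover obtain s where "s > 0" "F (b + s) < F b"
    using eventually_happens'[OF _ eventually_conj[OF decr[OF b] eventually_at_right_less[of "0::real"]]] by auto
  ultimately show False using F_ge[of "b + s"] b by auto
qed

section \<open>Reflection above a gap\<close>

lemma L2_convex_line_finite:
  assumes conv: "L2_convex M E" and k: "k \<in> L2 M" and h: "h \<in> L2 M"
    and a: "E (\<lambda>x. k x + a * h x) < \<infinity>" and b: "E (\<lambda>x. k x + b * h x) < \<infinity>"
    and c: "a \<le> c" "c \<le> (b::real)"
  shows "E (\<lambda>x. k x + c * h x) < \<infinity>"
proof (cases "a = b")
  case True
  then show ?thesis using a c by (simp add: antisym)
next
  case False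
  then have "a < b" using c by auto
  define s where "s = (c - a) / (b - a)"
  have s: "0 \<le> s" "s \<le> 1" using c \<open>a < b\<close> by (auto simp: s_def)
  have "c = a + s * (b - a)" using \<open>a < b\<close> by (simp add: s_def)
  then have eq: "(\<lambda>x. k x + c * h x) = (\<lambda>x. (1 - s) * (k x + a * h x) + s * (k x + b * h x))"
    by (subst \<open>c = _\<close>) (simp add: algebra_simps)
  have "(\<lambda>x. k x + r * h x) \<in> L2 M" for r by (rule L2_add[OF k L2_cmult[OF h]])
  then have "E (\<lambda>x. (1 - s) * (k x + a * h x) + s * (k x + b * h x)) < \<infinity>"
    using a b s by (intro L2_convex_finite[where E=E and M=M, OF conv]) auto
  then show ?thesis by (simp only: eq)
qed

text \<open>
  Let \<open>u s = f - h + s h\<close> and \<open>v s = g + s h\<close>. Wherever \<open>h > 0\<close>, the gap of \<open>u s\<close> and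
  \<open>v t\<close> exceeds \<open>\<alpha>\<close> by \<open>(s - t) h\<close>; so for \<open>t \<le> s\<close> the projection moves both
  parameters to their midpoint. On a grid of width \<open>1/N\<close> this reads
  \<open>E (u (k+1)) + E (v (k+1)) \<le> E (u (k+2)) + E (v k)\<close>, that is, the increment of \<open>E\<close> along
  \<open>u\<close> dominates the preceding increment along \<open>v\<close>. The sum of these inequalities compares
  the whole segments up to one grid step at each end, and these steps vanish in the limit.
\<close>
lemma gap_reflection_energy_le:
  assumes D: "nonbilinear_dirichlet_form M E"
    and f: "f \<in> L2 M" and g: "g \<in> L2 M" and \<alpha>: "0 \<le> \<alpha>"
  shows "E (\<lambda>x. f x - max (f x - g x - \<alpha>) 0) + E (\<lambda>x. g x + max (f x - g x - \<alpha>) 0) \<le> E f + E g"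
proof (cases "E f + E g < \<infinity>")
  case False
  then have "E f + E g = top" unfolding infinity_ennreal_def less_top[symmetric] by simp
  then show ?thesis by (simp only: top_greatest)
next
  case True
  define h where "h = (\<lambda>x. max (f x - g x - \<alpha>) 0)"
  have h: "h \<in> L2 M" unfolding h_def by (intro L2_positive_excess L2_diff f g \<alpha>)
  have fh: "(\<lambda>x. f x - h x) \<in> L2 M" using f h by auto
  have conv: "L2_convex M E" and lsc: "L2_lsc M E" using D by (auto simp: nonbilinear_dirichlet_form_def)
  define u v where "u = (\<lambda>s x. f x - h x + s * h x)" and "v = (\<lambda>s x. g x + s * h x)"
  have u: "u s \<in> L2 M" and v: "v s \<in> L2 M" for s
    unfolding u_def v_def by (intro L2_add L2_cmult fh g h)+
  have mid: "E (u ((s + t) / 2)) + E (v ((s + t) / 2)) \<le> E (u s) + E (v t)" if "t \<le> s" for s t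
  proof -
    have *: "max (u s x - v t x - \<alpha>) 0 = (s - t) * h x" for x
    proof (cases "h x = 0")
      case True
      then show ?thesis by (simp add: u_def v_def) (auto simp: h_def max_def split: if_splits)
    next
      case False
      then have "h x > 0" "f x - g x - \<alpha> = h x" by (auto simp: h_def max_def split: if_splits)
      then have "u s x - v t x - \<alpha> = (s - t) * h x" "(s - t) * h x \<ge> 0"
        using that by (simp_all add: u_def v_def algebra_simps mult_right_mono)
      then show ?thesis by simp
    qed
    have "(\<lambda>x. u s x - (s - t) * h x / 2) = u ((s + t) / 2)" "(\<lambda>x. v t x + (s - t) * h x / 2) = v ((s + t) / 2)"
      by (auto simp: u_def v_def field_simps)
    with gap_projection_energy_le[OF D u v \<alpha>, of s t] show ?thesis by (simp add: *)
  qed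
  have u1: "u 1 = f" and v0: "v 0 = g" by (auto simp: u_def v_def)
  have fin1: "E (u 1) < \<infinity>" "E (v 0) < \<infinity>" using True by (auto simp: u1 v0)
  \<comment> \<open>Telescoping needs finite energies at all grid points but the outermost ones. Repeated
    midpoints with the two given end points reach the extreme points of a dyadic grid, and convexity
    gives those in between.\<close>
  have finu: "E (u ((1/2)^n)) < \<infinity>" for n
  proof (induction n)
    case (Suc n)
    have "E (u ((1/2)^Suc n)) + E (v ((1/2)^Suc n)) \<le> E (u ((1/2)^n)) + E (v 0)"
      using mid[of 0 "(1/2)^n"] by simp
    also have "\<dots> < \<infinity>" using Suc fin1 by simp
    finally show ?case by simp
  qed (use fin1 in simp)
  have finv: "E (v (1 - (1/2)^n)) < \<infinity>" for n
  proof (induction n)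
    case (Suc n)
    have "(1 + (1 - y)) / 2 = 1 - 1/2 * y" for y :: real by (simp add: field_simps)
    then have eq: "(1 + (1 - (1/2)^n)) / 2 = 1 - (1/2::real)^Suc n" by simp
    have "E (u (1 - (1/2)^Suc n)) + E (v (1 - (1/2)^Suc n)) \<le> E (u 1) + E (v (1 - (1/2)^n))"
      using mid[of "1 - (1/2)^n" 1] unfolding eq by simp
    also have "\<dots> < \<infinity>" using Suc fin1 by simp
    finally show ?case by simp
  qed (use fin1 in simp)
  have step: "E (u ((1/2)^n)) + E (v (1 - (1/2)^n)) \<le> E f + E g" for n :: nat
  proof -
    define N :: nat where "N = 2 ^ n"
    have N: "N \<ge> 1" "(1/2)^n = 1 / real N" by (auto simp: N_def power_divide)
    have fu: "E (u (real k / N)) < \<infinity>" if "1 \<le> k" "k \<le> N" for k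
      using L2_convex_line_finite[OF conv fh h, of "1 / real N" 1 "real k / N"] finu[of n] fin1(1) that N
      by (simp add: u_def divide_right_mono)
    have fv: "E (v (real k / N)) < \<infinity>" if "k + 1 \<le> N" for k
    proof -
      have "real k / N \<le> 1 - 1 / N" using that N by (simp add: field_simps)
      then show ?thesis
      using L2_convex_line_finite[OF conv g h, of 0 "1 - 1 / real N" "real k / N"] finv[of n] fin1(2) that N
      by (simp add: v_def)
    qed
    define a b where "a = (\<lambda>k. enn2real (E (u (real k / N))))" and "b = (\<lambda>k. enn2real (E (v (real k / N))))"
    have ab: "E (u (real k / N)) = ennreal (a k)" if "1 \<le> k" "k \<le> N" for k
      using fu[OF that] by (simp add: a_def)
    have bb: "E (v (real k / N)) = ennreal (b k)" if "k + 1 \<le> N" for k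
      using fv[OF that] by (simp add: b_def)
    have ab0: "a k \<ge> 0" "b k \<ge> 0" for k by (auto simp: a_def b_def)
    have diff: "a (k + 1) + b (k + 1) \<le> a (k + 2) + b k" if "k + 2 \<le> N" for k
    proof -
      have eq: "(real (k + 2) / N + real k / N) / 2 = real (k + 1) / N" by (simp add: add_divide_distrib)
      have "E (u (real (k + 1) / N)) + E (v (real (k + 1) / N)) \<le> E (u (real (k + 2) / N)) + E (v (real k / N))"
        using mid[of "real k / N" "real (k + 2) / N"] unfolding eq by (simp add: divide_right_mono)
      then have "ennreal (a (k + 1)) + ennreal (b (k + 1)) \<le> ennreal (a (k + 2)) + ennreal (b k)"
        using ab[of "k + 1"] ab[of "k + 2"] bb[of "k + 1"] bb[of k] that by simp
      then show ?thesis using ab0 by (simp flip: ennreal_plus)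
    qed
    have tele: "a 1 + b m \<le> a (m + 1) + b 0" if "m + 1 \<le> N" for m
      using that
    proof (induction m)
      case (Suc m)
      then show ?case using diff[of m] by simp
    qed simp
    have "a 1 + b (N - 1) \<le> a N + b 0" using tele[of "N - 1"] N by simp
    then have "ennreal (a 1) + ennreal (b (N - 1)) \<le> ennreal (a N) + ennreal (b 0)"
      using ab0 by (simp flip: ennreal_plus)
    then have "E (u (real 1 / N)) + E (v (real (N - 1) / N)) \<le> E (u (real N / N)) + E (v (real 0 / N))"
      using ab[of 1] ab[of N] bb[of "N - 1"] bb[of 0] N(1) by simp
    moreover have "real (N - 1) / N = 1 - 1 / N" using N by (simp add: field_simps of_nat_diff)
    ultimately show ?thesis using N by (simp add: u1 v0)
  qed
  have lim: "((\<lambda>n. (1/2) ^ n * L2_norm M h) \<longlonglongrightarrow> 0)"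
    using tendsto_mult[OF LIMSEQ_realpow_zero[of "1/2::real"] tendsto_const[of "L2_norm M h"]] by simp
  have "E (\<lambda>x. f x - h x) + E (\<lambda>x. g x + h x) \<le> E f + E g"
  proof (rule L2_lsc_add_le[OF lsc sequentially_bot])
    have "L2_norm M (\<lambda>x. u ((1/2)^n) x - (f x - h x)) = (1/2)^n * L2_norm M h" for n
      using L2_norm_cmult[of M "(1/2)^n" h] by (simp add: u_def)
    then show "(\<lambda>n. L2_norm M (\<lambda>x. u ((1/2)^n) x - (f x - h x))) \<longlonglongrightarrow> 0" using lim by simp
    have "L2_norm M (\<lambda>x. v (1 - (1/2)^n) x - (g x + h x)) = (1/2)^n * L2_norm M h" for n
      using L2_norm_cmult[of M "- ((1/2)^n)" h] by (simp add: v_def algebra_simps)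
    then show "(\<lambda>n. L2_norm M (\<lambda>x. v (1 - (1/2)^n) x - (g x + h x))) \<longlonglongrightarrow> 0" using lim by simp
  qed (use step u v fh g h in auto)
  then show ?thesis by (simp add: h_def)
qed

section \<open>Supermodularity along pairs of directions\<close>

definition supermodular_along :: "'a measure \<Rightarrow> (('a \<Rightarrow> real) \<Rightarrow> ennreal) \<Rightarrow> ('a \<Rightarrow> real) \<Rightarrow> ('a \<Rightarrow> real) \<Rightarrow> bool" where
  "supermodular_along M E p q \<longleftrightarrow> (\<forall>w\<in>L2 M.
     E (\<lambda>x. w x + p x) + E (\<lambda>x. w x + q x) \<le> E (\<lambda>x. w x + p x + q x) + E w)"

text \<open>
  Since \<open>p\<close> attains its maximum \<open>\<kappa>\<close> wherever \<open>q\<close> is positive, the part of \<open>p + q\<close> above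
  \<open>\<kappa>\<close> is exactly \<open>q\<close>. Reflecting the pair \<open>(w + p + q, w)\<close> above the gap \<open>\<kappa>\<close> therefore
  yields \<open>(w + p, w + q)\<close>.
\<close>
lemma supermodular_along_saturated_above:
  assumes D: "nonbilinear_dirichlet_form M E" and p: "p \<in> L2 M" and q: "q \<in> L2 M"
    and "0 \<le> \<kappa>" "\<And>x. p x \<le> \<kappa>" "\<And>x. 0 \<le> q x" "\<And>x. 0 < q x \<Longrightarrow> p x = \<kappa>"
  shows "supermodular_along M E p q"
  unfolding supermodular_along_def
proof
  fix w assume w: "w \<in> L2 M"
  have "max (w x + p x + q x - w x - \<kappa>) 0 = q x" for x
    using assms(5)[of x] assms(6)[of x] assms(7)[of x] by (cases "q x = 0") auto
  then show "E (\<lambda>x. w x + p x) + E (\<lambda>x. w x + q x) \<le> E (\<lambda>x. w x + p x + q x) + E w"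
    using gap_reflection_energy_le[OF D L2_add[OF L2_add[OF w p] q] w \<open>0 \<le> \<kappa>\<close>] by simp
qed

lemma supermodular_along_saturated_below:
  assumes D: "nonbilinear_dirichlet_form M E" and p: "p \<in> L2 M" and q: "q \<in> L2 M"
    and "0 \<le> \<kappa>" "\<And>x. - \<kappa> \<le> p x" "\<And>x. q x \<le> 0" "\<And>x. q x < 0 \<Longrightarrow> p x = - \<kappa>"
  shows "supermodular_along M E p q"
  unfolding supermodular_along_def
proof
  fix w assume w: "w \<in> L2 M"
  have "max (w x - (w x + p x + q x) - \<kappa>) 0 = - q x" for x
    using assms(5)[of x] assms(6)[of x] assms(7)[of x] by (cases "q x = 0") auto
  then show "E (\<lambda>x. w x + p x) + E (\<lambda>x. w x + q x) \<le> E (\<lambda>x. w x + p x + q x) + E w"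
    using gap_reflection_energy_le[OF D w L2_add[OF L2_add[OF w p] q] \<open>0 \<le> \<kappa>\<close>] by (simp add: add.commute)
qed

text \<open>
  Along a line, supermodularity is convexity.
\<close>
lemma supermodular_along_same_direction:
  assumes conv: "L2_convex M E" and m: "m \<in> L2 M" and s: "0 \<le> s" and t: "0 \<le> (t::real)"
  shows "supermodular_along M E (\<lambda>x. s * m x) (\<lambda>x. t * m x)"
  unfolding supermodular_along_def
proof
  fix w assume w: "w \<in> L2 M"
  show "E (\<lambda>x. w x + s * m x) + E (\<lambda>x. w x + t * m x) \<le> E (\<lambda>x. w x + s * m x + t * m x) + E w"
  proof (cases "s + t = 0")
    case True
    then have "s = 0" "t = 0" using s t by auto
    then show ?thesis by simp
  next
    case False
    define z where "z = (\<lambda>x. w x + s * m x + t * m x)"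
    define \<sigma> \<tau> where "\<sigma> = s / (s + t)" and "\<tau> = t / (s + t)"
    have st: "s + t > 0" using False s t by auto
    have "\<sigma> + \<tau> = 1" using st by (simp add: \<sigma>_def \<tau>_def flip: add_divide_distrib)
    then have eq: "(1 - \<sigma>) = \<tau>" "(1 - \<tau>) = \<sigma>" "\<sigma> * (s + t) = s" "\<tau> * (s + t) = t" "0 \<le> \<sigma>" "0 \<le> \<tau>" "\<sigma> \<le> 1" "\<tau> \<le> 1" "\<sigma> + \<tau> = 1"
      using st s t by (auto simp: \<sigma>_def \<tau>_def)
    have z: "z \<in> L2 M" unfolding z_def by (intro L2_add L2_cmult w m)
    have ineq: "E (\<lambda>x. (1 - r) * w x + r * z x) \<le> ennreal (1 - r) * E w + ennreal r * E z" if "0 \<le> r" "r \<le> 1" for r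
      using conv w z that unfolding L2_convex_def by blast
    have comb: "(1 - r) * w x + r * z x = w x + r * (s + t) * m x" for r x
      by (simp add: z_def algebra_simps)
    have "E (\<lambda>x. w x + s * m x) + E (\<lambda>x. w x + t * m x)
        \<le> (ennreal \<tau> * E w + ennreal \<sigma> * E z) + (ennreal \<sigma> * E w + ennreal \<tau> * E z)"
      using add_mono[OF ineq[OF eq(5,7)] ineq[OF eq(6,8)]] unfolding comb by (simp only: eq)
    also have "\<dots> = (ennreal \<sigma> + ennreal \<tau>) * E z + (ennreal \<sigma> + ennreal \<tau>) * E w"
      using eq by (simp add: algebra_simps)
    also have "ennreal \<sigma> + ennreal \<tau> = 1" using eq by (simp flip: ennreal_plus)
    finally show ?thesis by (simp add: z_def)
  qed
qed

text \<open>
  With \<open>\<sigma> = s m\<close> and \<open>\<tau> = t m\<close>, the claim is the sum of four inequalities after cancellation: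
  for \<open>p\<close> and \<open>q\<close> at \<open>w\<close>, for \<open>p\<close> and \<open>\<tau>\<close> at \<open>w + q\<close>, for \<open>q\<close> and \<open>\<sigma>\<close> at \<open>w + p\<close>,
  and for \<open>\<sigma>\<close> and \<open>\<tau>\<close> at \<open>w + p + q\<close>. The hypothesis on \<open>p + q\<close> provides the finiteness
  of the energy at \<open>w + p + q\<close>, from which the other cancelled terms inherit theirs.
\<close>
lemma supermodular_along_extend:
  assumes conv: "L2_convex M E" and p: "p \<in> L2 M" and q: "q \<in> L2 M" and m: "m \<in> L2 M"
    and s: "0 \<le> s" and t: "0 \<le> (t::real)"
    and pq: "supermodular_along M E p q"
    and pm: "supermodular_along M E p (\<lambda>x. t * m x)"
    and qm: "supermodular_along M E q (\<lambda>x. s * m x)"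
    and pqm: "supermodular_along M E (\<lambda>x. p x + q x) (\<lambda>x. (s + t) * m x)"
  shows "supermodular_along M E (\<lambda>x. p x + s * m x) (\<lambda>x. q x + t * m x)"
  unfolding supermodular_along_def
proof
  fix w assume w: "w \<in> L2 M"
  define \<sigma> where "\<sigma> = (\<lambda>x. s * m x)"
  define \<tau> where "\<tau> = (\<lambda>x. t * m x)"
  have L: "\<sigma> \<in> L2 M" "\<tau> \<in> L2 M" using m by (auto simp: \<sigma>_def \<tau>_def)
  let ?Z = "\<lambda>x. w x + (p x + \<sigma> x) + (q x + \<tau> x)"
  let ?A = "\<lambda>x. w x + p x + q x"
  have "E (\<lambda>x. w x + (p x + \<sigma> x)) + E (\<lambda>x. w x + (q x + \<tau> x)) \<le> E ?Z + E w"
  proof (cases "E ?Z + E w < \<infinity>")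
    case False
    then have "E ?Z + E w = top" unfolding infinity_ennreal_def less_top[symmetric] by simp
    then show ?thesis by (simp only: top_greatest)
  next
    case True
    then have Z: "E ?Z < \<infinity>" and W: "E w < \<infinity>" by auto
    have "E (\<lambda>x. w x + (p x + q x)) + E (\<lambda>x. w x + (s + t) * m x) \<le> E (\<lambda>x. w x + (p x + q x) + (s + t) * m x) + E w"
      using pqm w by (simp add: supermodular_along_def)
    also have "(\<lambda>x. w x + (p x + q x) + (s + t) * m x) = ?Z" by (auto simp: \<sigma>_def \<tau>_def algebra_simps)
    finally have "E (\<lambda>x. w x + (p x + q x)) + E (\<lambda>x. w x + (s + t) * m x) < \<infinity>"
      using True by (rule le_less_trans)
    then have A: "E ?A < \<infinity>" by (auto simp: add.assoc)
    have i2: "E (\<lambda>x. w x + p x) + E (\<lambda>x. w x + q x) \<le> E ?A + E w"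
      using pq w by (simp add: supermodular_along_def)
    have PQ: "E (\<lambda>x. w x + p x) < \<infinity>" "E (\<lambda>x. w x + q x) < \<infinity>" using le_less_trans[OF i2, of \<infinity>] A W by auto
    have AL: "?A \<in> L2 M" by (intro L2_add w p q)
    have i4: "E (\<lambda>x. ?A x + \<sigma> x) + E (\<lambda>x. ?A x + \<tau> x) \<le> E ?Z + E ?A"
      using supermodular_along_same_direction[OF conv m s t] AL 
      unfolding supermodular_along_def \<sigma>_def[symmetric] \<tau>_def[symmetric]
      by (auto simp: algebra_simps)
    have B: "E (\<lambda>x. ?A x + \<sigma> x) < \<infinity>" "E (\<lambda>x. ?A x + \<tau> x) < \<infinity>" using le_less_trans[OF i4, of \<infinity>] A Z by auto
    have i1: "E ?A + E (\<lambda>x. w x + (q x + \<tau> x)) \<le> E (\<lambda>x. ?A x + \<tau> x) + E (\<lambda>x. w x + q x)"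
      using bspec[OF pm[unfolded supermodular_along_def] L2_add[OF w q]] by (simp add: \<tau>_def algebra_simps)
    have i3: "E ?A + E (\<lambda>x. w x + (p x + \<sigma> x)) \<le> E (\<lambda>x. ?A x + \<sigma> x) + E (\<lambda>x. w x + p x)"
      using bspec[OF qm[unfolded supermodular_along_def] L2_add[OF w p]] by (simp add: \<sigma>_def algebra_simps)
    have X: "E (\<lambda>x. w x + (q x + \<tau> x)) < \<infinity>" "E (\<lambda>x. w x + (p x + \<sigma> x)) < \<infinity>"
      using le_less_trans[OF i1, of \<infinity>] le_less_trans[OF i3, of \<infinity>] A B PQ by auto
    have real: "\<exists>r\<ge>0. y = ennreal r" if "y < \<infinity>" for y using that by (cases y) auto
    note R = real[OF Z] real[OF W] real[OF A] real[OF PQ(1)] real[OF PQ(2)] real[OF B(1)] real[OF B(2)] real[OF X(1)] real[OF X(2)]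
    show ?thesis using i1 i2 i3 i4 R
      by (elim exE conjE) (simp flip: ennreal_plus)
  qed
  then show "E (\<lambda>x. w x + (p x + s * m x)) + E (\<lambda>x. w x + (q x + t * m x)) \<le> E (\<lambda>x. w x + (p x + s * m x) + (q x + t * m x)) + E w"
    by (simp add: \<sigma>_def \<tau>_def)
qed

section \<open>Piecewise linear functions as sums of layers\<close>

text \<open>
  The identity on the half-line \<open>y \<ge> 0\<close> is cut at the multiples of \<open>\<epsilon>\<close>: layer \<open>k\<close> is the
  part of \<open>y\<close> that lies between \<open>k \<epsilon>\<close> and \<open>(k + 1) \<epsilon>\<close>, and in \<open>layer_sum \<epsilon> c n\<close> the number
  \<open>c k\<close> is the slope there.
\<close>
definition layer :: "real \<Rightarrow> nat \<Rightarrow> real \<Rightarrow> real" where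
  "layer \<epsilon> k y = min (max (y - real k * \<epsilon>) 0) \<epsilon>"

definition layer_sum :: "real \<Rightarrow> (nat \<Rightarrow> real) \<Rightarrow> nat \<Rightarrow> real \<Rightarrow> real" where
  "layer_sum \<epsilon> c n y = (\<Sum>k<n. c k * layer \<epsilon> k y)"

lemma layer_bounds: "\<epsilon> > 0 \<Longrightarrow> 0 \<le> layer \<epsilon> k y" "layer \<epsilon> k y \<le> \<epsilon>"
  by (auto simp: layer_def)

lemma layer_eq_0: "\<epsilon> > 0 \<Longrightarrow> y \<le> real k * \<epsilon> \<Longrightarrow> layer \<epsilon> k y = 0"
  by (auto simp: layer_def)

lemma layer_full: "\<epsilon> > 0 \<Longrightarrow> real (Suc k) * \<epsilon> \<le> y \<Longrightarrow> layer \<epsilon> k y = \<epsilon>"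
  by (auto simp: layer_def algebra_simps)

lemma layer_sum_nonpos_arg:
  assumes "\<epsilon> > 0" "y \<le> 0"
  shows "layer_sum \<epsilon> c n y = 0"
proof -
  have "0 \<le> real k * \<epsilon>" for k using assms by simp
  from order_trans[OF assms(2) this] have "layer \<epsilon> k y = 0" for k by (rule layer_eq_0[OF assms(1)])
  then show ?thesis by (simp add: layer_sum_def)
qed

lemma layer_sum_full:
  assumes "\<epsilon> > 0" "real n * \<epsilon> \<le> y"
  shows "layer_sum \<epsilon> c n y = (\<Sum>k<n. c k) * \<epsilon>"
proof -
  have "layer \<epsilon> k y = \<epsilon>" if "k < n" for k
  proof (rule layer_full[OF assms(1)])
    have "real (Suc k) * \<epsilon> \<le> real n * \<epsilon>" using that assms(1) by (intro mult_right_mono) auto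
    with assms(2) show "real (Suc k) * \<epsilon> \<le> y" by simp
  qed
  then show ?thesis by (simp add: layer_sum_def sum_distrib_right)
qed

lemma layer_sum_bounds:
  assumes "\<epsilon> > 0" "\<And>k. 0 \<le> c k"
  shows "0 \<le> layer_sum \<epsilon> c n y" "layer_sum \<epsilon> c n y \<le> (\<Sum>k<n. c k) * \<epsilon>"
  using assms unfolding layer_sum_def sum_distrib_right
  by (auto intro!: sum_nonneg sum_mono mult_left_mono layer_bounds mult_nonneg_nonneg)

lemma layer_sum_1:
  assumes "\<epsilon> > 0"
  shows "layer_sum \<epsilon> (\<lambda>_. 1) n y = min (max y 0) (real n * \<epsilon>)"
proof (induction n)
  case (Suc n)
  have *: "min (max y 0) t + min (max (y - t) 0) \<epsilon> = min (max y 0) (t + \<epsilon>)" if "0 \<le> t" for t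
    using that assms by auto
  have "layer_sum \<epsilon> (\<lambda>_. 1) (Suc n) y = min (max y 0) (real n * \<epsilon>) + layer \<epsilon> n y"
    using Suc by (simp add: layer_sum_def)
  also have "\<dots> = min (max y 0) (real n * \<epsilon> + \<epsilon>)"
    using assms unfolding layer_def by (intro *) simp
  finally show ?case by (simp add: algebra_simps)
qed (simp add: layer_sum_def)

lemma abs_layer_sum_le:
  assumes "\<epsilon> > 0" "\<And>k. \<bar>c k\<bar> \<le> 1"
  shows "\<bar>layer_sum \<epsilon> c n y\<bar> \<le> max y 0"
proof -
  have "\<bar>layer_sum \<epsilon> c n y\<bar> \<le> (\<Sum>k<n. \<bar>c k * layer \<epsilon> k y\<bar>)"
    unfolding layer_sum_def by (rule sum_abs)
  also have "\<dots> \<le> layer_sum \<epsilon> (\<lambda>_. 1) n y" unfolding layer_sum_def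
    using assms by (intro sum_mono) (simp add: abs_mult layer_bounds mult_left_le_one_le)
  also have "\<dots> \<le> max y 0" using layer_sum_1[OF assms(1)] by simp
  finally show ?thesis .
qed

lemma L2_layer_sum:
  assumes f: "f \<in> L2 M" and \<epsilon>: "\<epsilon> > 0"
  shows "(\<lambda>x. layer_sum \<epsilon> c n (f x)) \<in> L2 M"
proof (induction n)
  case 0
  then show ?case by (simp add: layer_sum_def L2_def)
next
  case (Suc n)
  have "(\<lambda>x. layer \<epsilon> n (f x)) \<in> L2 M"
  proof (rule L2_dominated[OF f])
    show "(\<lambda>x. layer \<epsilon> n (f x)) \<in> borel_measurable M"
      unfolding layer_def using L2_measurable[OF f] by measurable
    have "\<bar>min (max (y - t) 0) \<epsilon>\<bar> \<le> \<bar>y\<bar>" if "0 \<le> t" for y t using that \<epsilon> by auto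
    then show "\<bar>layer \<epsilon> n (f x)\<bar> \<le> \<bar>f x\<bar>" for x
      using \<epsilon> by (simp add: layer_def)
  qed
  from L2_add[OF Suc L2_cmult[OF this]] show ?case by (simp add: layer_sum_def)
qed

text \<open>
  With difference quotients as slopes, \<open>layer_sum\<close> agrees with \<open>\<phi>\<close> at the grid points, and
  between two of them both functions vary by at most \<open>\<epsilon>\<close>.
\<close>
lemma layer_sum_interpolates:
  fixes \<phi> :: "real \<Rightarrow> real"
  assumes \<epsilon>: "\<epsilon> > 0" and \<phi>: "normal_contraction \<phi>"
  defines "c \<equiv> \<lambda>k. (\<phi> (real (Suc k) * \<epsilon>) - \<phi> (real k * \<epsilon>)) / \<epsilon>"
  shows "\<bar>c k\<bar> \<le> 1"
    and "0 \<le> y \<Longrightarrow> y \<le> real n * \<epsilon> \<Longrightarrow> \<bar>layer_sum \<epsilon> c n y - \<phi> y\<bar> \<le> 2 * \<epsilon>"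
proof -
  have lip: "\<bar>\<phi> a - \<phi> b\<bar> \<le> \<bar>a - b\<bar>" for a b
    using \<phi> lipschitz_onD[of 1 UNIV \<phi> a b] by (simp add: normal_contraction_def dist_real_def)
  have \<phi>0: "\<phi> 0 = 0" using \<phi> by (simp add: normal_contraction_def)
  show c1: "\<bar>c k\<bar> \<le> 1" for k
    using lip[of "real (Suc k) * \<epsilon>" "real k * \<epsilon>"] \<epsilon> by (simp add: c_def algebra_simps)
  have "c k * \<epsilon> = \<phi> (real (Suc k) * \<epsilon>) - \<phi> (real k * \<epsilon>)" for k using \<epsilon> by (simp add: c_def)
  then have sumc: "(\<Sum>k<n. c k) * \<epsilon> = \<phi> (real n * \<epsilon>)" for n
    using \<phi>0 by (induction n) (simp_all add: distrib_right)
  show "\<bar>layer_sum \<epsilon> c n y - \<phi> y\<bar> \<le> 2 * \<epsilon>" if "0 \<le> y" "y \<le> real n * \<epsilon>"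
    using that(2)
  proof (induction n)
    case 0
    then show ?case using that(1) \<phi>0 \<epsilon> by (simp add: layer_sum_def)
  next
    case (Suc n)
    have split: "layer_sum \<epsilon> c (Suc n) y = layer_sum \<epsilon> c n y + c n * layer \<epsilon> n y"
      by (simp add: layer_sum_def)
    show ?case
    proof (cases "y \<le> real n * \<epsilon>")
      case True
      then show ?thesis using Suc.IH \<epsilon> by (simp add: split layer_eq_0)
    next
      case False
      then have "layer_sum \<epsilon> c n y = \<phi> (real n * \<epsilon>)" using layer_sum_full[OF \<epsilon>, of n y c] sumc by simp
      moreover have "\<bar>c n * layer \<epsilon> n y\<bar> \<le> 1 * \<epsilon>"
        unfolding abs_mult using c1[of n] layer_bounds(1)[OF \<epsilon>, of n y] layer_bounds(2)[of \<epsilon> n y]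
        by (intro mult_mono) auto
      moreover have "\<bar>\<phi> (real n * \<epsilon>) - \<phi> y\<bar> \<le> \<epsilon>"
        using lip[of "real n * \<epsilon>" y] False Suc.prems by (simp add: algebra_simps)
      ultimately show ?thesis unfolding split by simp
    qed
  qed
qed

section \<open>Comonotone supermodularity\<close>

text \<open>
  The piecewise linear function with slopes \<open>a k\<close> on the positive and \<open>a' k\<close> on the negative
  half-line, counted away from \<open>0\<close>, and constant beyond \<open>n \<epsilon>\<close> and \<open>- n' \<epsilon>\<close>.
\<close>
definition layered :: "real \<Rightarrow> nat \<Rightarrow> nat \<Rightarrow> (nat \<Rightarrow> real) \<Rightarrow> (nat \<Rightarrow> real) \<Rightarrow> real \<Rightarrow> real" where
  "layered \<epsilon> n n' a a' y = layer_sum \<epsilon> a n y - layer_sum \<epsilon> a' n' (- y)"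

lemma L2_layered: "f \<in> L2 M \<Longrightarrow> \<epsilon> > 0 \<Longrightarrow> (\<lambda>x. layered \<epsilon> n n' a a' (f x)) \<in> L2 M"
  unfolding layered_def by (intro L2_diff L2_layer_sum L2_uminus)

text \<open>
  Both functions are nondecreasing. They are built up simultaneously, one layer at a time: the next
  positive layer is nonzero only where all functions built so far have reached their maximum, and
  the next negative one only where they have reached their minimum.
\<close>
lemma supermodular_along_layered:
  assumes D: "nonbilinear_dirichlet_form M E" and f: "f \<in> L2 M" and \<epsilon>: "\<epsilon> > 0"
    and a: "\<And>k. 0 \<le> a k" "\<And>k. 0 \<le> a' k" and b: "\<And>k. 0 \<le> b k" "\<And>k. 0 \<le> b' k"
  shows "supermodular_along M E (\<lambda>x. layered \<epsilon> n n' a a' (f x)) (\<lambda>x. layered \<epsilon> n n' b b' (f x))"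
proof -
  have conv: "L2_convex M E" using D by (simp add: nonbilinear_dirichlet_form_def)
  have layer_L2: "(\<lambda>x. layer \<epsilon> k (g x)) \<in> L2 M" if "g \<in> L2 M" for k g
    using L2_diff[OF L2_layer_sum[OF that \<epsilon>, of "\<lambda>_. 1" "Suc k"] L2_layer_sum[OF that \<epsilon>, of "\<lambda>_. 1" k]]
    by (simp add: layer_sum_def)
  define up where "up = (\<lambda>k x. layer \<epsilon> k (f x))"
  define down where "down = (\<lambda>k x. - layer \<epsilon> k (- f x))"
  have up: "up k \<in> L2 M" and down: "down k \<in> L2 M" for k
    unfolding up_def down_def by (intro L2_uminus layer_L2 f)+
  have top: "supermodular_along M E (\<lambda>x. layered \<epsilon> n n' c c' (f x)) (\<lambda>x. s * up n x)"
    if c: "\<And>k. 0 \<le> c k" "\<And>k. 0 \<le> c' k" and s: "0 \<le> s" for n n' c c' s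
  proof (rule supermodular_along_saturated_above[OF D L2_layered[OF f \<epsilon>] L2_cmult[OF up]])
    show "0 \<le> (\<Sum>k<n. c k) * \<epsilon>" using c \<epsilon> by (simp add: sum_nonneg)
    show "layered \<epsilon> n n' c c' (f x) \<le> (\<Sum>k<n. c k) * \<epsilon>" for x
      using layer_sum_bounds(2)[OF \<epsilon>, of c n "f x"] layer_sum_bounds(1)[OF \<epsilon>, of c' n' "- f x"] c
      by (simp add: layered_def)
    show "0 \<le> s * up n x" for x using s layer_bounds(1)[OF \<epsilon>] by (simp add: up_def)
    show "layered \<epsilon> n n' c c' (f x) = (\<Sum>k<n. c k) * \<epsilon>" if "0 < s * up n x" for x
    proof -
      have "\<not> f x \<le> real n * \<epsilon>" using that layer_eq_0[OF \<epsilon>, of "f x" n] by (auto simp: up_def)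
      moreover have "0 \<le> real n * \<epsilon>" using \<epsilon> by simp
      ultimately have "real n * \<epsilon> \<le> f x" "- f x \<le> 0" by linarith+
      then show ?thesis using layer_sum_full[OF \<epsilon>] layer_sum_nonpos_arg[OF \<epsilon>] by (simp add: layered_def)
    qed
  qed
  have bottom: "supermodular_along M E (\<lambda>x. layered \<epsilon> n n' c c' (f x)) (\<lambda>x. s * down n' x)"
    if c: "\<And>k. 0 \<le> c k" "\<And>k. 0 \<le> c' k" and s: "0 \<le> s" for n n' c c' s
  proof (rule supermodular_along_saturated_below[OF D L2_layered[OF f \<epsilon>] L2_cmult[OF down]])
    show "0 \<le> (\<Sum>k<n'. c' k) * \<epsilon>" using c \<epsilon> by (simp add: sum_nonneg)
    show "- ((\<Sum>k<n'. c' k) * \<epsilon>) \<le> layered \<epsilon> n n' c c' (f x)" for x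
      using layer_sum_bounds(2)[OF \<epsilon>, of c' n' "- f x"] layer_sum_bounds(1)[OF \<epsilon>, of c n "f x"] c
      by (simp add: layered_def)
    show "s * down n' x \<le> 0" for x using s layer_bounds(1)[OF \<epsilon>] by (simp add: down_def)
    show "layered \<epsilon> n n' c c' (f x) = - ((\<Sum>k<n'. c' k) * \<epsilon>)" if "s * down n' x < 0" for x
    proof -
      have "\<not> - f x \<le> real n' * \<epsilon>" using that layer_eq_0[OF \<epsilon>, of "- f x" n'] by (auto simp: down_def)
      moreover have "0 \<le> real n' * \<epsilon>" using \<epsilon> by simp
      ultimately have "real n' * \<epsilon> \<le> - f x" "f x \<le> 0" by linarith+
      then show ?thesis using layer_sum_full[OF \<epsilon>] layer_sum_nonpos_arg[OF \<epsilon>] by (simp add: layered_def)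
    qed
  qed
  have sum: "(\<lambda>x. layered \<epsilon> n n' a a' (f x) + layered \<epsilon> n n' b b' (f x))
      = (\<lambda>x. layered \<epsilon> n n' (\<lambda>k. a k + b k) (\<lambda>k. a' k + b' k) (f x))" for n n'
    by (simp add: layered_def layer_sum_def distrib_right sum.distrib fun_eq_iff)
  define p q where "p = (\<lambda>n n' x. layered \<epsilon> n n' a a' (f x))" and "q = (\<lambda>n n' x. layered \<epsilon> n n' b b' (f x))"
  have pq_L2: "p n n' \<in> L2 M" "q n n' \<in> L2 M" for n n' unfolding p_def q_def by (rule L2_layered[OF f \<epsilon>])+
  have top_pq: "supermodular_along M E (p n n') (\<lambda>x. b n * up n x)"
    "supermodular_along M E (q n n') (\<lambda>x. a n * up n x)"
    "supermodular_along M E (\<lambda>x. p n n' x + q n n' x) (\<lambda>x. (a n + b n) * up n x)" for n n'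
    unfolding p_def q_def sum by (rule top; simp add: a b)+
  have bottom_pq: "supermodular_along M E (p n n') (\<lambda>x. b' n' * down n' x)"
    "supermodular_along M E (q n n') (\<lambda>x. a' n' * down n' x)"
    "supermodular_along M E (\<lambda>x. p n n' x + q n n' x) (\<lambda>x. (a' n' + b' n') * down n' x)" for n n'
    unfolding p_def q_def sum by (rule bottom; simp add: a b)+
  have Suc_up: "p (Suc n) n' = (\<lambda>x. p n n' x + a n * up n x)" "q (Suc n) n' = (\<lambda>x. q n n' x + b n * up n x)"
    and Suc_down: "p n (Suc n') = (\<lambda>x. p n n' x + a' n' * down n' x)" "q n (Suc n') = (\<lambda>x. q n n' x + b' n' * down n' x)" for n n'
    by (simp_all add: fun_eq_iff p_def q_def layered_def layer_sum_def up_def down_def)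
  have "supermodular_along M E (p n n') (q n n')"
  proof (induction n')
    case 0
    show ?case
    proof (induction n)
      case 0
      show ?case by (simp add: p_def q_def layered_def layer_sum_def supermodular_along_def)
    next
      case (Suc n)
      show ?case unfolding Suc_up
        using supermodular_along_extend[OF conv pq_L2 up a(1) b(1) Suc top_pq] .
    qed
  next
    case (Suc n')
    show ?case unfolding Suc_down
      using supermodular_along_extend[OF conv pq_L2 down a(2) b(2) Suc bottom_pq] .
  qed
  then show ?thesis by (simp add: p_def q_def)
qed

section \<open>Normal contractions\<close>

lemma ennreal_double_le_cancel: "a + a \<le> b + b \<Longrightarrow> a \<le> b" for a b :: ennreal
  using add_strict_mono[of b a b a] by (meson not_le)

text \<open>
  For a gap of \<open>2 \<alpha>\<close> the projection of the pair \<open>(f, - f)\<close> is \<open>(min f \<alpha>, - min f \<alpha>)\<close>.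
  The lower truncation is the upper one of \<open>- f\<close>.
\<close>
lemma energy_truncation_le:
  assumes D: "nonbilinear_dirichlet_form M E" and sym: "\<And>f. f \<in> L2 M \<Longrightarrow> E (\<lambda>x. - f x) = E f"
    and f: "f \<in> L2 M" and \<alpha>: "0 \<le> \<alpha>"
  shows "E (\<lambda>x. max (min (f x) \<alpha>) (- \<alpha>)) \<le> E f"
proof -
  have min_L2: "(\<lambda>x. min (g x) \<alpha>) \<in> L2 M" if "g \<in> L2 M" for g
    using that by (rule L2_dominated) (use that \<alpha> in \<open>auto intro!: borel_measurable_min\<close>)
  have *: "E (\<lambda>x. min (g x) \<alpha>) \<le> E g" if g: "g \<in> L2 M" for g
  proof -
    have "g x - max (g x - - g x - 2 * \<alpha>) 0 / 2 = min (g x) \<alpha>"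
         "- g x + max (g x - - g x - 2 * \<alpha>) 0 / 2 = - min (g x) \<alpha>" for x
      by (auto simp: max_def min_def field_simps)
    then have "E (\<lambda>x. min (g x) \<alpha>) + E (\<lambda>x. - min (g x) \<alpha>) \<le> E g + E (\<lambda>x. - g x)"
      using gap_projection_energy_le[OF D g L2_uminus[OF g], of "2 * \<alpha>"] \<alpha> by simp
    then show ?thesis unfolding sym[OF g] sym[OF min_L2[OF g]] by (rule ennreal_double_le_cancel)
  qed
  have m: "(\<lambda>x. - min (f x) \<alpha>) \<in> L2 M" by (intro L2_uminus min_L2 f)
  have "(\<lambda>x. max (min (f x) \<alpha>) (- \<alpha>)) = (\<lambda>x. - min (- min (f x) \<alpha>) \<alpha>)"
    by (auto simp: max_def min_def)
  then have "E (\<lambda>x. max (min (f x) \<alpha>) (- \<alpha>)) = E (\<lambda>x. min (- min (f x) \<alpha>) \<alpha>)"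
    using sym[OF min_L2[OF m]] by simp
  also have "\<dots> \<le> E (\<lambda>x. - min (f x) \<alpha>)" by (rule *[OF m])
  also have "\<dots> = E (\<lambda>x. min (f x) \<alpha>)" by (rule sym[OF min_L2[OF f]])
  also have "\<dots> \<le> E f" by (rule *[OF f])
  finally show ?thesis .
qed

text \<open>
  With all slopes equal to \<open>1\<close>, \<open>layered\<close> is the truncation \<open>w\<close> of \<open>f\<close>. Slopes \<open>1 + c\<close> and
  \<open>1 - c\<close> are nonnegative and add up to \<open>2\<close>, so starting at \<open>- w\<close> the comonotone increments
  lead to the contraction with slopes \<open>c\<close>, to its negative, and jointly to \<open>w\<close>.
\<close>
lemma energy_layered_contraction_le:
  assumes D: "nonbilinear_dirichlet_form M E" and sym: "\<And>f. f \<in> L2 M \<Longrightarrow> E (\<lambda>x. - f x) = E f"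
    and f: "f \<in> L2 M" and \<epsilon>: "\<epsilon> > 0" and c: "\<And>k. \<bar>c k\<bar> \<le> 1" "\<And>k. \<bar>c' k\<bar> \<le> 1"
  shows "E (\<lambda>x. layered \<epsilon> n n c c' (f x)) \<le> E f"
proof -
  define w where "w = (\<lambda>x. layered \<epsilon> n n (\<lambda>_. 1) (\<lambda>_. 1) (f x))"
  have w: "w \<in> L2 M" unfolding w_def by (rule L2_layered[OF f \<epsilon>])
  have nonneg: "0 \<le> 1 + c k" "0 \<le> 1 - c k" "0 \<le> 1 + c' k" "0 \<le> 1 - c' k" for k
    using c[of k] by auto
  have "E (\<lambda>x. - w x + layered \<epsilon> n n (\<lambda>k. 1 + c k) (\<lambda>k. 1 + c' k) (f x))
      + E (\<lambda>x. - w x + layered \<epsilon> n n (\<lambda>k. 1 - c k) (\<lambda>k. 1 - c' k) (f x))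
    \<le> E (\<lambda>x. - w x + layered \<epsilon> n n (\<lambda>k. 1 + c k) (\<lambda>k. 1 + c' k) (f x) + layered \<epsilon> n n (\<lambda>k. 1 - c k) (\<lambda>k. 1 - c' k) (f x))
      + E (\<lambda>x. - w x)"
    by (rule bspec[OF supermodular_along_layered[OF D f \<epsilon>, unfolded supermodular_along_def] L2_uminus[OF w]])
      (rule nonneg)+
  moreover have "- w x + layered \<epsilon> n n (\<lambda>k. 1 + c k) (\<lambda>k. 1 + c' k) (f x) = layered \<epsilon> n n c c' (f x)"
    "- w x + layered \<epsilon> n n (\<lambda>k. 1 - c k) (\<lambda>k. 1 - c' k) (f x) = - layered \<epsilon> n n c c' (f x)"
    "layered \<epsilon> n n c c' (f x) + layered \<epsilon> n n (\<lambda>k. 1 - c k) (\<lambda>k. 1 - c' k) (f x) = w x" for x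
    by (simp_all add: w_def layered_def layer_sum_def algebra_simps sum.distrib sum_subtractf)
  ultimately have "E (\<lambda>x. layered \<epsilon> n n c c' (f x)) + E (\<lambda>x. - layered \<epsilon> n n c c' (f x)) \<le> E w + E (\<lambda>x. - w x)"
    by simp
  then have "E (\<lambda>x. layered \<epsilon> n n c c' (f x)) \<le> E w"
    unfolding sym[OF w] sym[OF L2_layered[OF f \<epsilon>]] by (rule ennreal_double_le_cancel)
  also have "w = (\<lambda>x. max (min (f x) (real n * \<epsilon>)) (- (real n * \<epsilon>)))"
  proof
    fix x
    have "min (max y 0) t - min (max (- y) 0) t = max (min y t) (- t)" if "0 \<le> t" for y t :: real
      using that by auto
    then show "w x = max (min (f x) (real n * \<epsilon>)) (- (real n * \<epsilon>))"
      using \<epsilon> by (simp add: w_def layered_def layer_sum_1[OF \<epsilon>])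
  qed
  also have "E \<dots> \<le> E f" using \<epsilon> by (intro energy_truncation_le[OF D sym f]) auto
  finally show ?thesis .
qed

lemma energy_normal_contraction_le:
  assumes D: "nonbilinear_dirichlet_form M E" and sym: "\<And>f. f \<in> L2 M \<Longrightarrow> E (\<lambda>x. - f x) = E f"
    and f: "f \<in> L2 M" and \<phi>: "normal_contraction \<phi>"
  shows "E (\<phi> \<circ> f) \<le> E f"
proof -
  have lsc: "L2_lsc M E" using D by (simp add: nonbilinear_dirichlet_form_def)
  \<comment> \<open>The values of \<open>\<phi>\<close> on the negative half-line, as \<open>layered\<close> counts them.\<close>
  define \<psi> where "\<psi> = (\<lambda>y. - \<phi> (- y))"
  have lip: "\<bar>\<phi> a - \<phi> b\<bar> \<le> \<bar>a - b\<bar>" for a b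
    using \<phi> lipschitz_onD[of 1 UNIV \<phi> a b] by (simp add: normal_contraction_def dist_real_def)
  have \<phi>0: "\<phi> 0 = 0" using \<phi> by (simp add: normal_contraction_def)
  have \<psi>: "normal_contraction \<psi>"
    using lip[of "- _" "- _"] \<phi>0 by (auto simp: normal_contraction_def \<psi>_def dist_real_def intro!: lipschitz_onI) 
      (smt (verit, best) lip)
  define \<epsilon> where "\<epsilon> = (\<lambda>N. 1 / real (Suc N))"
  define c where "c = (\<lambda>\<theta> N k. (\<theta> (real (Suc k) * \<epsilon> N) - \<theta> (real k * \<epsilon> N)) / \<epsilon> N)" for \<theta> :: "real \<Rightarrow> real"
  \<comment> \<open>With mesh \<open>1 / (N + 1)\<close>, this many layers cover the interval from \<open>- (N + 1)\<close> to \<open>N + 1\<close>,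
    so that the mesh shrinks while the interval exhausts the line.\<close>
  define \<Phi> where "\<Phi> = (\<lambda>N. layered (\<epsilon> N) (Suc N * Suc N) (Suc N * Suc N) (c \<phi> N) (c \<psi> N))"
  have \<epsilon>: "\<epsilon> N > 0" "real (Suc N * Suc N) * \<epsilon> N = real (Suc N)" for N
    unfolding \<epsilon>_def of_nat_mult by (simp_all del: of_nat_Suc)
  have c: "\<bar>c \<phi> N k\<bar> \<le> 1" "\<bar>c \<psi> N k\<bar> \<le> 1" for N k
    unfolding c_def using layer_sum_interpolates(1)[OF \<epsilon>(1)] \<phi> \<psi> by blast+
  have \<Phi>_L2: "(\<lambda>x. \<Phi> N (f x)) \<in> L2 M" for N unfolding \<Phi>_def by (rule L2_layered[OF f \<epsilon>(1)])
  have \<Phi>_le: "\<bar>\<Phi> N y\<bar> \<le> \<bar>y\<bar>" for N y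
    using abs_layer_sum_le[where c="c \<phi> N", OF \<epsilon>(1)[of N] c(1), of "Suc N * Suc N" y]
      abs_layer_sum_le[where c="c \<psi> N", OF \<epsilon>(1)[of N] c(2), of "Suc N * Suc N" "- y"]
    by (simp add: \<Phi>_def layered_def)
  have close: "\<bar>\<Phi> N y - \<phi> y\<bar> \<le> 2 * \<epsilon> N" if "\<bar>y\<bar> \<le> real (Suc N)" for N y
  proof (cases "0 \<le> y")
    case True
    then show ?thesis
      using layer_sum_interpolates(2)[OF \<epsilon>(1) \<phi> True, of "Suc N * Suc N" N] that \<epsilon>(2)[of N]
      by (simp add: \<Phi>_def layered_def c_def layer_sum_nonpos_arg[OF \<epsilon>(1)])
  next
    case False
    then show ?thesis
      using layer_sum_interpolates(2)[OF \<epsilon>(1) \<psi>, of "- y" "Suc N * Suc N" N] that \<epsilon>(2)[of N]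
      by (simp add: \<Phi>_def layered_def c_def layer_sum_nonpos_arg[OF \<epsilon>(1)] \<psi>_def)
  qed
  have \<phi>_meas: "\<phi> \<in> borel_measurable borel"
    using \<phi> lipschitz_on_continuous_on by (intro borel_measurable_continuous_onI) (auto simp: normal_contraction_def)
  have \<phi>_le: "\<bar>\<phi> y\<bar> \<le> \<bar>y\<bar>" for y using lip[of y 0] \<phi>0 by simp
  have \<phi>f: "(\<lambda>x. \<phi> (f x)) \<in> L2 M"
    by (rule L2_dominated[OF f measurable_compose[OF L2_measurable[OF f] \<phi>_meas]]) (rule \<phi>_le)
  have pointwise: "(\<lambda>N. \<Phi> N y) \<longlonglongrightarrow> \<phi> y" for y
  proof (rule LIM_zero_cancel, rule Lim_null_comparison)
    show "(\<lambda>N. 2 * \<epsilon> N) \<longlonglongrightarrow> 0"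
      using tendsto_mult_right_zero[OF LIMSEQ_Suc[OF lim_1_over_n], of 2] by (simp add: \<epsilon>_def)
    obtain N0 :: nat where "\<bar>y\<bar> \<le> real N0" using real_arch_simple by blast
    then have "\<bar>y\<bar> \<le> real (Suc N)" if "N0 \<le> N" for N using that by simp
    then show "eventually (\<lambda>N. norm (\<Phi> N y - \<phi> y) \<le> 2 * \<epsilon> N) sequentially"
      using close by (auto simp: eventually_sequentially)
  qed
  have "(\<lambda>N. \<integral>x. (\<Phi> N (f x) - \<phi> (f x))\<^sup>2 \<partial>M) \<longlonglongrightarrow> (\<integral>x. 0 \<partial>M)"
  proof (rule integral_dominated_convergence[where w="\<lambda>x. 4 * (f x)\<^sup>2"])
    show "(\<lambda>x. (\<Phi> N (f x) - \<phi> (f x))\<^sup>2) \<in> borel_measurable M" for N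
      using L2_measurable[OF L2_diff[OF \<Phi>_L2 \<phi>f]] by measurable
    show "integrable M (\<lambda>x. 4 * (f x)\<^sup>2)" using L2_integrable_square[OF f] by simp
    have "(\<lambda>N. (\<Phi> N y - \<phi> y)\<^sup>2) \<longlonglongrightarrow> 0" for y
      using tendsto_power[OF LIM_zero[OF pointwise[of y]], of 2] by simp
    then show "AE x in M. (\<lambda>N. (\<Phi> N (f x) - \<phi> (f x))\<^sup>2) \<longlonglongrightarrow> 0" by simp
    have "(\<Phi> N y - \<phi> y)\<^sup>2 \<le> 4 * y\<^sup>2" for N y
    proof -
      have "\<bar>\<Phi> N y - \<phi> y\<bar> \<le> \<bar>2 * y\<bar>" using \<Phi>_le[of N y] \<phi>_le[of y] by linarith
      then have "(\<Phi> N y - \<phi> y)\<^sup>2 \<le> (2 * y)\<^sup>2" by (rule abs_le_square_iff[THEN iffD1])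
      then show ?thesis by (simp add: power_mult_distrib)
    qed
    then show "AE x in M. norm ((\<Phi> N (f x) - \<phi> (f x))\<^sup>2) \<le> 4 * (f x)\<^sup>2" for N by simp
  qed simp
  then have lim: "(\<lambda>N. L2_norm M (\<lambda>x. \<Phi> N (f x) - \<phi> (f x))) \<longlonglongrightarrow> 0"
    unfolding L2_norm_def using tendsto_real_sqrt by fastforce
  have "E (\<lambda>x. \<Phi> N (f x)) \<le> E f" for N
    unfolding \<Phi>_def by (rule energy_layered_contraction_le[OF D sym f \<epsilon>(1) c])
  then have le: "eventually (\<lambda>N. E (\<lambda>x. \<Phi> N (f x)) + E (\<lambda>x. \<Phi> N (f x)) \<le> E f + E f) sequentially"
    by (intro always_eventually allI add_mono)
  have "eventually (\<lambda>N. (\<lambda>x. \<Phi> N (f x)) \<in> L2 M) sequentially" by (simp add: \<Phi>_L2)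
  from L2_lsc_add_le[where E=E, OF lsc sequentially_bot \<phi>f \<phi>f this this lim lim le]
  have "E (\<lambda>x. \<phi> (f x)) + E (\<lambda>x. \<phi> (f x)) \<le> E f + E f" .
  then show ?thesis unfolding comp_def by (rule ennreal_double_le_cancel)
qed

theorem theorem1p2:
  fixes M :: "'a measure" and E :: "('a \<Rightarrow> real) \<Rightarrow> ennreal"
  assumes "sigma_finite_measure M" and "space M \<noteq> {}"
    and "nonbilinear_dirichlet_form M E"
  shows "normal_contraction_property M E \<longleftrightarrow> (\<forall>f\<in>L2 M. E (\<lambda>x. - f x) \<le> E f)"
proof
  assume "normal_contraction_property M E"
  moreover have "normal_contraction uminus"
    by (auto simp: normal_contraction_def dist_real_def intro!: lipschitz_onI)
  ultimately show "\<forall>f\<in>L2 M. E (\<lambda>x. - f x) \<le> E f"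
    unfolding normal_contraction_property_def comp_def by blast
next
  assume le: "\<forall>f\<in>L2 M. E (\<lambda>x. - f x) \<le> E f"
  have "E (\<lambda>x. - f x) = E f" if f: "f \<in> L2 M" for f
  proof (rule antisym)
    show "E (\<lambda>x. - f x) \<le> E f" using le f by blast
    show "E f \<le> E (\<lambda>x. - f x)" using bspec[OF le L2_uminus[OF f]] by simp
  qed
  then show "normal_contraction_property M E"
    unfolding normal_contraction_property_def using energy_normal_contraction_le[OF assms(3)] by blast
qed

end
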